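(* Let $\Omega\subset\mathbb{R}^d$ be a domain with a sufficiently smooth boundary such that for every $D>0$ there exists a point $h_D\in\Omega$ with $d(h_D,\partial\Omega)\ge D$. Let $f\in C(\mathbb{R},\mathbb{R})$ satisfy $f(u)u\ge -C+|u|^{2+\varepsilon}$ for all $u\in\mathbb{R}$, with some constants $C$ and $\varepsilon>0$. Let $\Phi:=C_b(\mathbb{R}^d)$ be endowed with the (metrizable) topology of $C_{loc}(\mathbb{R}^d)$, let $(S(h)u)(x):=u(x+h)$, $h\in\mathbb{R}^d$, be the group of translations on $\Phi$, and let $\mathbb{B}$ be the collection of all sets $B\subset\Phi$ such that 1. $B$ is bounded in the norm of $C_b(\mathbb{R}^d)$; 2. for every $\tilde u\in B$, the restriction $\tilde u|_\Omega$ is a solution of the elliptic problem $$\Delta u-f(u)=0\ \text{ in }\Omega,\qquad u\big|_{\partial\Omega}=u_0,$$ for some boundary data $u_0\in C_b(\partial\Omega)$. Then, with the cone $\mathcal{C}=\mathbb{R}^d$ and the time arrow $\Sigma:=\Omega$, the group $S(h):\Phi\to\Phi$, $h\in\mathbb{R}^d$, possesses a $(\mathbb{B},\Sigma)$-attractor $\mathcal{A}$ which is generated by the set $\mathcal{K}$ of all complete bounded (in $C_b(\mathbb{R}^d)$) solutions of $\Delta u-f(u)=0$ defined on the whole space $\mathbb{R}^d$, i.e. $\mathcal{A}=\mathcal{K}$.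
   Context: - $C_b(V)$ is the space of bounded continuous functions on $V$ with the sup norm; $C_{loc}(\mathbb{R}^d)$ carries the topology of uniform convergence on compact sets. Solutions of the elliptic equation are understood in the weak (distributional) sense. - $d(h,V)$ is the Euclidean distance from the point $h\in\mathbb{R}^d$ to the set $V$, with $d(h,\emptyset)=+\infty$. - A set $K\subset\Phi$ is $(\mathbb{B},\Sigma)$-attracting if for every $B\in\mathbb{B}$ and every neighbourhood $\mathcal{O}(K)$ of $K$ in $\Phi$ there is $D=D(B,\mathcal{O})$ such that $S(h)B\subset\mathcal{O}(K)$ for all $h\in\Sigma$ with $d(h,\partial\Sigma)\ge D$. - A set $\mathcal{A}\subset\Phi$ is a $(\mathbb{B},\Sigma)$-attractor of the group $S(h)$, $h\in\mathcal{C}=\mathbb{R}^d$, if (1) $\mathcal{A}$ is compact in $\Phi$; (2) $\mathcal{A}$ is strictly invariant: $S(h)\mathcal{A}=\mathcal{A}$ for all $h\in\mathbb{R}^d$; (3) $\mathcal{A}$ is $(\mathbb{B},\Sigma)$-attracting. *)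

theory Defs
  imports "HOL-Analysis.Analysis"
begin

text \<open>
  The distance takes values in the extended reals because the distance to the empty set has to be
  infinite; \<open>infdist\<close> and \<open>setdist\<close> give \<open>0\<close> there.
\<close>

definition ext_dist :: "'a::metric_space \<Rightarrow> 'a set \<Rightarrow> ereal" where
  "ext_dist h V = (INF v\<in>V. ereal (dist h v))"

lemma ext_dist_empty: "ext_dist h {} = \<infinity>"
  by (simp add: ext_dist_def top_ereal_def)


text \<open>
  The library topology of \<open>'a \<Rightarrow>\<^sub>C 'b\<close> is that of the supremum norm; \<open>cloc\<close> is the
  coarser topology of uniform convergence on compact sets, on the same type.
\<close>

definition cloc_ball ::
    "('a::metric_space \<Rightarrow>\<^sub>C 'b::metric_space) \<Rightarrow> 'a set \<Rightarrow> real \<Rightarrow> ('a \<Rightarrow>\<^sub>C 'b) set" where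
  "cloc_ball u K e = {v :: 'a \<Rightarrow>\<^sub>C 'b. \<forall>x\<in>K. dist (u x) (v x) < e}"

definition cloc_open :: "('a::metric_space \<Rightarrow>\<^sub>C 'b::metric_space) set \<Rightarrow> bool" where
  "cloc_open W \<longleftrightarrow>
     (\<forall>u\<in>W. \<exists>K e. compact K \<and> 0 < e \<and> cloc_ball u K e \<subseteq> W)"

lemma istopology_cloc_open: "istopology (cloc_open :: ('a::metric_space \<Rightarrow>\<^sub>C 'b::metric_space) set \<Rightarrow> bool)"
  unfolding istopology_def
proof (intro conjI allI impI)
  fix S T :: "('a \<Rightarrow>\<^sub>C 'b) set"
  assume S: "cloc_open S" and T: "cloc_open T"
  show "cloc_open (S \<inter> T)"
    unfolding cloc_open_def
  proof
    fix u assume u: "u \<in> S \<inter> T"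
    obtain K e where K: "compact K" "0 < e" "cloc_ball u K e \<subseteq> S"
      using S u unfolding cloc_open_def by blast
    obtain L d where L: "compact L" "0 < d" "cloc_ball u L d \<subseteq> T"
      using T u unfolding cloc_open_def by blast
    have "compact (K \<union> L)" "0 < min e d"
      using K L by (auto intro: compact_Un)
    moreover have "cloc_ball u (K \<union> L) (min e d) \<subseteq> S \<inter> T"
      using K(3) L(3) unfolding cloc_ball_def by auto
    ultimately show "\<exists>K e. compact K \<and> 0 < e \<and> cloc_ball u K e \<subseteq> S \<inter> T"
      by blast
  qed
next
  fix \<K> :: "('a \<Rightarrow>\<^sub>C 'b) set set"
  assume *: "\<forall>K\<in>\<K>. cloc_open K"
  show "cloc_open (\<Union>\<K>)"
    unfolding cloc_open_def
  proof
    fix u assume "u \<in> \<Union>\<K>"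
    then obtain S where "S \<in> \<K>" "u \<in> S" by blast
    with * obtain K e where "compact K" "0 < e" "cloc_ball u K e \<subseteq> S"
      unfolding cloc_open_def by blast
    with \<open>S \<in> \<K>\<close> show
      "\<exists>K e. compact K \<and> 0 < e \<and> cloc_ball u K e \<subseteq> \<Union>\<K>"
      by blast
  qed
qed

definition cloc :: "('a::metric_space \<Rightarrow>\<^sub>C 'b::metric_space) topology" where
  "cloc = topology cloc_open"

lemma openin_cloc: "openin cloc W \<longleftrightarrow> cloc_open W"
  by (simp add: cloc_def topology_inverse' istopology_cloc_open)

lemma topspace_cloc: "topspace cloc = (UNIV :: ('a::metric_space \<Rightarrow>\<^sub>C 'b::metric_space) set)"
proof -
  have "cloc_open (UNIV :: ('a \<Rightarrow>\<^sub>C 'b) set)"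
    unfolding cloc_open_def using compact_empty zero_less_one by blast
  then show ?thesis
    by (metis openin_cloc openin_subset top.extremum_uniqueI)
qed

definition translate ::
    "'a::real_normed_vector \<Rightarrow> ('a \<Rightarrow>\<^sub>C 'b::metric_space) \<Rightarrow> ('a \<Rightarrow>\<^sub>C 'b)" where
  "translate h u = Bcontfun (\<lambda>x. u (x + h))"

lemma apply_translate: "apply_bcontfun (translate h u) x = u (x + h)"
proof -
  have "continuous_on UNIV (\<lambda>x. u (x + h))"
    by (rule continuous_on_compose2[of UNIV "apply_bcontfun u"])
      (auto intro!: continuous_intros continuous_on_apply_bcontfun)
  moreover have "bounded (range (\<lambda>x. u (x + h)))"
    using apply_bcontfun[of u] by (auto simp: bcontfun_def intro: bounded_subset)
  ultimately show ?thesis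
    unfolding translate_def by (subst Bcontfun_inverse) (auto simp: bcontfun_def)
qed


text \<open>\<open>S\<close> is the action on the phase space \<open>topspace T\<close>, \<open>BB\<close> the collection of sets to be
  attracted, and \<open>Sg\<close> the time arrow.\<close>

definition nbhd_of_set :: "'p topology \<Rightarrow> 'p set \<Rightarrow> 'p set \<Rightarrow> bool" where
  "nbhd_of_set T K N \<longleftrightarrow> N \<subseteq> topspace T \<and> (\<exists>W. openin T W \<and> K \<subseteq> W \<and> W \<subseteq> N)"

definition attracting ::
    "'p topology \<Rightarrow> ('a::metric_space \<Rightarrow> 'p \<Rightarrow> 'p) \<Rightarrow> 'p set set \<Rightarrow> 'a set \<Rightarrow> 'p set \<Rightarrow> bool" where
  "attracting T S BB Sg K \<longleftrightarrow>
     K \<subseteq> topspace T \<and>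
     (\<forall>B\<in>BB. \<forall>N. nbhd_of_set T K N \<longrightarrow>
        (\<exists>D::real. \<forall>h\<in>Sg. ext_dist h (frontier Sg) \<ge> ereal D \<longrightarrow> S h ` B \<subseteq> N))"

definition attractor ::
    "'p topology \<Rightarrow> ('a::metric_space \<Rightarrow> 'p \<Rightarrow> 'p) \<Rightarrow> 'p set set \<Rightarrow> 'a set \<Rightarrow> 'p set \<Rightarrow> bool" where
  "attractor T S BB Sg A \<longleftrightarrow>
     compactin T A \<and> (\<forall>h. S h ` A = A) \<and> attracting T S BB Sg A"


text \<open>Meant for open \<open>U\<close>: the derivatives are taken within the whole space.\<close>

primrec Ck_on :: "nat \<Rightarrow> ('a::euclidean_space \<Rightarrow> real) \<Rightarrow> 'a set \<Rightarrow> bool" where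
  "Ck_on 0 g U \<longleftrightarrow> continuous_on U g"
| "Ck_on (Suc k) g U \<longleftrightarrow>
     (\<forall>x\<in>U. g differentiable (at x)) \<and>
     (\<forall>v. Ck_on k (\<lambda>x. frechet_derivative g (at x) v) U)"

text \<open>
  The boundary is locally the zero set of a \<open>C\<^sup>k\<close> function with nonvanishing gradient, and
  \<open>\<Omega>\<close> lies locally on one side of it.
\<close>

definition Ck_boundary :: "nat \<Rightarrow> 'a::euclidean_space set \<Rightarrow> bool" where
  "Ck_boundary k \<Omega> \<longleftrightarrow>
     (\<forall>p\<in>frontier \<Omega>. \<exists>U g. open U \<and> p \<in> U \<and> Ck_on k g U \<and>
        (\<forall>x\<in>U. frechet_derivative g (at x) \<noteq> (\<lambda>v. 0)) \<and>
        \<Omega> \<inter> U = {x\<in>U. g x < 0})"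

definition laplacian :: "('a::euclidean_space \<Rightarrow> real) \<Rightarrow> 'a \<Rightarrow> real" where
  "laplacian g x =
     (\<Sum>b\<in>Basis. frechet_derivative (\<lambda>y. frechet_derivative g (at y) b) (at x) b)"

definition test_function :: "'a::euclidean_space set \<Rightarrow> ('a \<Rightarrow> real) \<Rightarrow> bool" where
  "test_function \<Omega> \<phi> \<longleftrightarrow>
     (\<forall>k. Ck_on k \<phi> UNIV) \<and> compact (closure {x. \<phi> x \<noteq> 0}) \<and> closure {x. \<phi> x \<noteq> 0} \<subseteq> \<Omega>"

text \<open>
  Distributional solutions of \<open>\<Delta>u - f(u) = 0\<close> in the open set \<open>\<Omega>\<close>. Only the values of \<open>u\<close> on
  \<open>\<Omega>\<close> matter. Both integrands are integrable whenever \<open>u\<close> and \<open>f\<close> are continuous.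
\<close>

definition weak_solution ::
    "(real \<Rightarrow> real) \<Rightarrow> 'a::euclidean_space set \<Rightarrow> ('a \<Rightarrow> real) \<Rightarrow> bool" where
  "weak_solution f \<Omega> u \<longleftrightarrow>
     (\<forall>\<phi>. test_function \<Omega> \<phi> \<longrightarrow>
        (LINT x:\<Omega>|lborel. u x * laplacian \<phi> x) = (LINT x:\<Omega>|lborel. f (u x) * \<phi> x))"

text \<open>
  The elliptic boundary value problem with data \<open>u0\<close> on \<open>frontier \<Omega>\<close>, for \<open>u\<close> continuous up to
  the boundary, so that the boundary condition holds pointwise.
\<close>

definition elliptic_bvp_solution ::
    "(real \<Rightarrow> real) \<Rightarrow> 'a::euclidean_space set \<Rightarrow> ('a \<Rightarrow> real) \<Rightarrow> ('a \<Rightarrow> real) \<Rightarrow> bool" where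
  "elliptic_bvp_solution f \<Omega> u0 u \<longleftrightarrow>
     continuous_on (closure \<Omega>) u \<and> weak_solution f \<Omega> u \<and> (\<forall>x\<in>frontier \<Omega>. u x = u0 x)"

definition admissible_sets ::
    "(real \<Rightarrow> real) \<Rightarrow> 'a::euclidean_space set \<Rightarrow> ('a \<Rightarrow>\<^sub>C real) set set" where
  "admissible_sets f \<Omega> =
     {B. bounded B \<and>
         (\<forall>u\<in>B. \<exists>u0. continuous_on (frontier \<Omega>) u0 \<and> bounded (u0 ` frontier \<Omega>) \<and>
                     elliptic_bvp_solution f \<Omega> u0 (apply_bcontfun u))}"

definition complete_bounded_solutions ::
    "(real \<Rightarrow> real) \<Rightarrow> ('a::euclidean_space \<Rightarrow>\<^sub>C real) set" where
  "complete_bounded_solutions f = {u. weak_solution f UNIV (apply_bcontfun u)}"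

end

theory Submission
  imports Defs
begin

text \<open>
  A translate of a solution on \<open>\<Omega>\<close> by a point \<open>h\<close> far from the boundary solves the equation on a large ball
  about the origin. Hence limits of such translates, as the distance to the boundary tends to infinity,
  solve the equation on the whole space. If bounded families of solutions are precompact for local
  uniform convergence, these limits exist, and the set of entire bounded solutions attracts
  (\<open>attracting_complete_bounded_solutions\<close>). That set is translation invariant, and it is compact once all
  its members obey one common bound. Precompactness and the common bound are the analytic content.

  Both come from one mean value inequality for distributional solutions. Let \<open>\<eta>\<close> be a smooth radial bump and
  \<open>\<eta>\<^sub>r(y) = r\<^bsup>-d\<^esup> \<eta>(y/r)\<close>. The derivative of \<open>\<eta>\<^sub>r\<close> in \<open>r\<close> is the Laplacian of a nonnegative test function
  \<open>\<phi>\<^sub>r\<close> with integral proportional to \<open>r\<close> (\<open>laplacian_bump\<close> and \<open>kern_has_derivative\<close>). Testing the equation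
  with \<open>\<phi>\<^sub>r\<close> shows that the average of a solution \<open>u\<close> against \<open>\<eta>\<^sub>r\<close> has \<open>r\<close>-derivative \<open>\<integral> f(u) \<phi>\<^sub>r\<close>, so that
  bounds on \<open>f(u)\<close> over a ball control the difference between \<open>u\<close> at its centre and the average
  (\<open>average_ge_of_weak_solution\<close>). No differentiability of \<open>u\<close> is involved.

  If \<open>|f(u)|\<close> is bounded, \<open>u\<close> is uniformly close to its averages over small balls, and these are
  equicontinuous; so are the solutions (\<open>bounded_weak_solutions_equicontinuous\<close>), and a Tychonoff argument
  yields cluster points (\<open>bounded_solutions_cluster\<close>). Where \<open>u\<close> is large, coercivity makes \<open>f(u)\<close>
  positive and the averages exceed the value at the centre; near the supremum of a bounded entire
  solution this is absurd, so \<open>u \<le> |C| + 1\<close> everywhere. The lower bound follows by reflecting \<open>u\<close>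
  (\<open>entire_bounded_solution_abs_le\<close>).
\<close>

section \<open>Smooth functions that vanish on a half-line\<close>

text \<open>
  The functions \<open>p(1/t) exp(-1/t)\<close>, extended by \<open>0\<close> to \<open>t \<le> 0\<close>. Polynomial factors are carried along
  because they make the family closed under differentiation: \<open>flat_deriv\<close> is the chain rule for
  \<open>s = 1/t\<close>, with \<open>ds/dt = - s\<^sup>2\<close>. Smoothness of every member then needs a single derivative
  computation.
\<close>

definition flat :: "real poly \<Rightarrow> real \<Rightarrow> real" where
  "flat p t = (if t > 0 then poly p (1 / t) * exp (- (1 / t)) else 0)"

definition flat_deriv :: "real poly \<Rightarrow> real poly" where
  "flat_deriv p = [:0, 0, 1:] * (p - pderiv p)"

lemma poly_mult_exp_minus_tendsto_0:
  fixes p :: "real poly"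
  shows "((\<lambda>s. poly p s * exp (- s)) \<longlongrightarrow> 0) at_top"
proof -
  have "((\<lambda>s::real. \<Sum>i\<le>degree p. coeff p i * (s ^ i / exp s)) \<longlongrightarrow>
      (\<Sum>i\<le>degree p. coeff p i * 0)) at_top"
    by (intro tendsto_sum tendsto_mult tendsto_const tendsto_power_div_exp_0)
  moreover have "(\<lambda>s::real. \<Sum>i\<le>degree p. coeff p i * (s ^ i / exp s)) =
      (\<lambda>s. poly p s * exp (- s))"
    unfolding poly_altdef sum_distrib_right by (simp add: exp_minus field_simps)
  ultimately show ?thesis by simp
qed

lemma flat_quotient_tendsto_0: "((\<lambda>t. flat p t / t) \<longlongrightarrow> 0) (at 0)"
proof -
  have "((\<lambda>t. poly ([:0, 1:] * p) (inverse t) * exp (- inverse t)) \<longlongrightarrow> 0) (at_right (0::real))"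
    by (rule filterlim_compose[OF poly_mult_exp_minus_tendsto_0 filterlim_inverse_at_top_right])
  then have right: "((\<lambda>t. flat p t / t) \<longlongrightarrow> 0) (at_right 0)"
    by (rule Lim_transform_eventually)
      (auto simp: eventually_at_filter flat_def field_simps intro!: always_eventually)
  have left: "((\<lambda>t. flat p t / t) \<longlongrightarrow> 0) (at_left 0)"
    by (rule tendsto_eventually) (auto simp: eventually_at_filter flat_def intro!: always_eventually)
  show ?thesis
    using left right by (simp add: filterlim_at_split)
qed

text \<open>
  Away from \<open>0\<close> this is calculus; at \<open>0\<close> the difference quotient is \<open>flat p t / t\<close>, which vanishes in
  the limit because \<open>exp(-s)\<close> beats every polynomial in \<open>s = 1/t\<close>.
\<close>

lemma flat_has_derivative:
  "(flat p has_real_derivative flat (flat_deriv p) t) (at t)"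
proof -
  consider "t > 0" | "t < 0" | "t = 0" by linarith
  then show ?thesis
  proof cases
    case 1
    have "((\<lambda>t. poly p (1 / t) * exp (- (1 / t))) has_real_derivative flat (flat_deriv p) t) (at t)"
      using 1 by (auto intro!: derivative_eq_intros poly_DERIV[THEN DERIV_chain2]
          simp: flat_def flat_deriv_def field_simps power2_eq_square)
    then show ?thesis
      by (rule DERIV_cong_ev[THEN iffD1, rotated 3])
        (use 1 in \<open>auto simp: flat_def eventually_nhds intro!: exI[of _ "{0<..}"]\<close>)
  next
    case 2
    have "((\<lambda>t. 0) has_real_derivative flat (flat_deriv p) t) (at t)"
      using 2 by (simp add: flat_def)
    then show ?thesis
      by (rule DERIV_cong_ev[THEN iffD1, rotated 3])
        (use 2 in \<open>auto simp: flat_def eventually_nhds intro!: exI[of _ "{..<0}"]\<close>)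
  next
    case 3
    then show ?thesis
      using flat_quotient_tendsto_0[of p] by (simp add: DERIV_def flat_def)
  qed
qed

lemma continuous_on_flat [continuous_intros]:
  "continuous_on S g \<Longrightarrow> continuous_on S (\<lambda>x. flat p (g x))"
proof (rule continuous_on_compose2[of UNIV "flat p"])
  show "continuous_on UNIV (flat p)"
    by (rule continuous_at_imp_continuous_on) (blast intro: DERIV_isCont flat_has_derivative)
qed simp_all

section \<open>Differentiability of all orders\<close>

text \<open>
  \<open>Ck_on\<close> is phrased with the choice operator \<open>frechet_derivative\<close>; this rule lets one exhibit the
  derivative instead.
\<close>

lemma Ck_on_SucI:
  assumes "\<And>x. (g has_derivative D x) (at x)" and "\<And>v. Ck_on k (\<lambda>x. D x v) UNIV"
  shows "Ck_on (Suc k) g UNIV"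
proof -
  have "frechet_derivative g (at x) = D x" for x
    using assms(1) by (metis frechet_derivative_at)
  then show ?thesis
    using assms by (auto simp: differentiable_def)
qed

lemma Ck_on_SucD: "Ck_on (Suc k) g UNIV \<Longrightarrow> Ck_on k g UNIV"
proof (induction k arbitrary: g)
  case 0
  then show ?case
    by (auto intro!: continuous_at_imp_continuous_on differentiable_imp_continuous_within)
next
  case (Suc k)
  then show ?case
    using Suc.IH[of "\<lambda>x. frechet_derivative g (at x) _"] by (simp del: Ck_on.simps(1))
qed

lemma Ck_on_const: "Ck_on k (\<lambda>x. c) UNIV"
  by (induction k arbitrary: c) (auto simp: frechet_derivative_const)

lemma Ck_on_add:
  "Ck_on k g UNIV \<Longrightarrow> Ck_on k h UNIV \<Longrightarrow> Ck_on k (\<lambda>x. g x + h x) UNIV"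
proof (induction k arbitrary: g h)
  case 0
  then show ?case by (auto intro!: continuous_intros)
next
  case (Suc k)
  show ?case
    by (rule Ck_on_SucI[where D = "\<lambda>x v. frechet_derivative g (at x) v + frechet_derivative h (at x) v"])
      (use Suc in \<open>auto intro!: has_derivative_add simp: frechet_derivative_works[symmetric]\<close>)
qed

lemma Ck_on_mult:
  "Ck_on k g UNIV \<Longrightarrow> Ck_on k h UNIV \<Longrightarrow> Ck_on k (\<lambda>x. g x * h x) UNIV"
proof (induction k arbitrary: g h)
  case 0
  then show ?case by (auto intro!: continuous_intros)
next
  case (Suc k)
  have "Ck_on k g UNIV" "Ck_on k h UNIV"
    using Suc.prems by (blast intro: Ck_on_SucD)+
  then show ?case
    by (intro Ck_on_SucI[where D = "\<lambda>x v. g x * frechet_derivative h (at x) v + frechet_derivative g (at x) v * h x"])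
      (use Suc in \<open>auto intro!: has_derivative_mult Ck_on_add simp: frechet_derivative_works[symmetric]\<close>)
qed

lemma Ck_on_flat:
  assumes q: "\<And>k. Ck_on k q UNIV"
  shows "Ck_on k (\<lambda>x. flat p (q x)) UNIV"
proof (induction k arbitrary: p)
  case 0
  then show ?case using q[of 0] by (auto intro!: continuous_intros)
next
  case (Suc k)
  have dq: "(q has_derivative frechet_derivative q (at x)) (at x)"
    and Cq: "Ck_on k (\<lambda>x. frechet_derivative q (at x) v) UNIV" for x v
    using q[of "Suc k"] by (auto simp: frechet_derivative_works[symmetric])
  have "((\<lambda>x. flat p (q x)) has_derivative
      (\<lambda>v. flat (flat_deriv p) (q x) * frechet_derivative q (at x) v)) (at x)" for x
    using has_derivative_compose[OF dq flat_has_derivative[unfolded has_field_derivative_def]]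
    by simp
  then show ?case
    using Ck_on_mult[OF Suc Cq] by (rule Ck_on_SucI)
qed

lemma Ck_on_inner_diff: "Ck_on k (\<lambda>z. (z - x) \<bullet> w) UNIV"
proof (cases k)
  case 0
  then show ?thesis by (auto intro!: continuous_intros)
next
  case (Suc k)
  show ?thesis
    unfolding Suc
    by (rule Ck_on_SucI[where D = "\<lambda>x v. v \<bullet> w"])
      (auto intro!: derivative_eq_intros Ck_on_const)
qed

section \<open>A radial kernel whose derivative in the radius is a Laplacian\<close>

text \<open>
  Positive exactly on the ball of radius \<open>r\<close> about \<open>x\<close>, and quadratic in \<open>z\<close>, so that smooth radial
  functions arise by composing \<open>flat\<close> with it, without a singularity at the centre.
\<close>

definition cap :: "'a::euclidean_space \<Rightarrow> real \<Rightarrow> 'a \<Rightarrow> real" where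
  "cap x r z = 1 - (inverse r)\<^sup>2 * ((z - x) \<bullet> (z - x))"

lemma cap_has_derivative:
  "(cap x r has_derivative (\<lambda>v. (z - x) \<bullet> (- (2 * (inverse r)\<^sup>2) *\<^sub>R v))) (at z)"
  unfolding cap_def
  by (auto intro!: derivative_eq_intros simp: inner_commute algebra_simps)

lemma Ck_on_cap: "Ck_on k (cap x r) UNIV"
proof (cases k)
  case 0
  then show ?thesis unfolding cap_def by (auto intro!: continuous_intros)
next
  case (Suc k)
  show ?thesis
    unfolding Suc by (rule Ck_on_SucI[OF cap_has_derivative Ck_on_inner_diff])
qed

lemma continuous_on_cap [continuous_intros]:
  "continuous_on S g \<Longrightarrow> continuous_on S (\<lambda>z. cap x r (g z))"
  unfolding cap_def by (auto intro!: continuous_intros)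

lemma cap_pos_iff: "r > 0 \<Longrightarrow> cap x r z > 0 \<longleftrightarrow> dist x z < r"
proof -
  assume r: "r > 0"
  have "cap x r z > 0 \<longleftrightarrow> (norm (z - x))\<^sup>2 < r\<^sup>2"
    using r by (simp add: cap_def power2_norm_eq_inner field_simps)
  also have "\<dots> \<longleftrightarrow> norm (z - x) < r"
    using r by (metis norm_ge_zero power_strict_mono power2_less_imp_less less_eq_real_def zero_less_numeral)
  finally show ?thesis by (simp add: dist_norm norm_minus_commute)
qed

lemma flat_cap_eq_0: "r > 0 \<Longrightarrow> r \<le> dist x z \<Longrightarrow> flat p (cap x r z) = 0"
  using cap_pos_iff[of r x z] by (auto simp: flat_def)

text \<open>
  Writing \<open>E(t) = exp(-1/t)\<close> for \<open>t > 0\<close> and \<open>q = 1 - |z - x|\<^sup>2/r\<^sup>2\<close>, with \<open>d\<close> the dimension, \<open>bump\<close> is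
  \<open>r\<^bsup>1-d\<^esup> E(q)/2\<close> and \<open>kern\<close> is \<open>r\<^bsup>-d\<^esup> E'(q)\<close>, that is \<open>r\<^bsup>-d\<^esup> \<eta>((z-x)/r)\<close> for a fixed profile \<open>\<eta>\<close>. Since the
  vector field \<open>y \<eta>(y)\<close> is a gradient of a compactly supported function, the radial derivative
  \<open>- div (y \<eta>)\<close> of the rescaled profile is a Laplacian, namely that of \<open>bump\<close>; \<open>kern_deriv\<close> is the common
  value.
\<close>

definition bump :: "'a::euclidean_space \<Rightarrow> real \<Rightarrow> 'a \<Rightarrow> real" where
  "bump x r z = r / (2 * r ^ DIM('a)) * flat 1 (cap x r z)"

definition kern :: "'a::euclidean_space \<Rightarrow> real \<Rightarrow> 'a \<Rightarrow> real" where
  "kern x r z = flat (flat_deriv 1) (cap x r z) / r ^ DIM('a)"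

definition kern_deriv :: "'a::euclidean_space \<Rightarrow> real \<Rightarrow> 'a \<Rightarrow> real" where
  "kern_deriv x r z =
     (2 * ((z - x) \<bullet> (z - x)) / r ^ 3 * flat (flat_deriv (flat_deriv 1)) (cap x r z)
      - DIM('a) / r * flat (flat_deriv 1) (cap x r z)) / r ^ DIM('a)"

lemma test_function_bump:
  assumes "r > 0" and "cball x r \<subseteq> \<Omega>"
  shows "test_function \<Omega> (bump x r)"
proof -
  have "{z. bump x r z \<noteq> 0} \<subseteq> cball x r"
    using flat_cap_eq_0[OF \<open>r > 0\<close>] by (force simp: bump_def)
  then have sub: "closure {z. bump x r z \<noteq> 0} \<subseteq> cball x r"
    by (simp add: closure_minimal)
  then have "compact (closure {z. bump x r z \<noteq> 0})"
    by (meson bounded_cball bounded_subset closed_closure compact_eq_bounded_closed)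
  moreover have "Ck_on k (bump x r) UNIV" for k
    unfolding bump_def[abs_def] by (intro Ck_on_mult Ck_on_const Ck_on_flat Ck_on_cap)
  ultimately show ?thesis
    using sub assms(2) by (auto simp: test_function_def)
qed

lemma laplacian_bump:
  assumes "r > 0"
  shows "laplacian (bump x r) z = kern_deriv x r z"
proof -
  define c where "c = r / (2 * r ^ DIM('a))"
  define m where "m = - (2 * (inverse r)\<^sup>2)"
  have bump: "bump x r = (\<lambda>z. c * flat 1 (cap x r z))"
    by (simp add: bump_def[abs_def] c_def)
  have flat_cap: "((\<lambda>z. flat p (cap x r z)) has_derivative
      (\<lambda>v. flat (flat_deriv p) (cap x r y) * ((y - x) \<bullet> m *\<^sub>R v))) (at y)" for p y
    using has_derivative_compose[OF cap_has_derivative flat_has_derivative[unfolded has_field_derivative_def]]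
    by (simp add: m_def)
  have 1: "frechet_derivative (bump x r) (at y) =
      (\<lambda>b. c * (flat (flat_deriv 1) (cap x r y) * ((y - x) \<bullet> m *\<^sub>R b)))" for y
    unfolding bump
    by (intro frechet_derivative_at[symmetric] has_derivative_mult_right flat_cap)
  have 2: "frechet_derivative (\<lambda>y. frechet_derivative (bump x r) (at y) b) (at z) =
     (\<lambda>v. c * (flat (flat_deriv 1) (cap x r z) * (v \<bullet> m *\<^sub>R b)
        + (flat (flat_deriv (flat_deriv 1)) (cap x r z) * ((z - x) \<bullet> m *\<^sub>R v))
           * ((z - x) \<bullet> m *\<^sub>R b)))" for b
    unfolding 1
    by (intro frechet_derivative_at[symmetric] has_derivative_mult_right has_derivative_mult flat_cap)
      (auto intro!: derivative_eq_intros)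
  let ?F1 = "flat (flat_deriv 1) (cap x r z)" and ?F2 = "flat (flat_deriv (flat_deriv 1)) (cap x r z)"
  have "laplacian (bump x r) z =
      (\<Sum>b\<in>Basis. c * m * ?F1 + c * m\<^sup>2 * ?F2 * (((z - x) \<bullet> b) * ((z - x) \<bullet> b)))"
    unfolding laplacian_def 2
    by (rule sum.cong) (auto simp: inner_Basis algebra_simps power2_eq_square)
  also have "\<dots> = DIM('a) * (c * m * ?F1) + c * m\<^sup>2 * ?F2 * ((z - x) \<bullet> (z - x))"
    by (simp add: sum.distrib sum_distrib_left[symmetric] euclidean_inner[of "z - x" "z - x"])
  also have "\<dots> = kern_deriv x r z"
    using assms by (simp add: kern_deriv_def c_def m_def field_simps power2_eq_square power3_eq_cube)
  finally show ?thesis .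
qed

lemma kern_has_derivative:
  assumes "r > 0"
  shows "((\<lambda>r. kern x r z) has_real_derivative kern_deriv x r z) (at r within S)"
proof -
  have cap: "((\<lambda>r. cap x r z) has_real_derivative 2 * ((z - x) \<bullet> (z - x)) / r ^ 3) (at r)"
    unfolding cap_def using assms
    by (auto intro!: derivative_eq_intros simp: field_simps power2_eq_square power3_eq_cube)
  obtain n where n: "DIM('a) = Suc n"
    by (metis DIM_positive gr0_conv_Suc)
  have "((\<lambda>r. kern x r z) has_real_derivative kern_deriv x r z) (at r)"
    unfolding kern_def
    using assms
    by (auto intro!: derivative_eq_intros DERIV_chain2[OF flat_has_derivative cap]
         simp: kern_deriv_def n diff_divide_distrib)
      (cases n; simp add: field_simps power2_eq_square)
  then show ?thesis
    by (rule has_field_derivative_at_within)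
qed

section \<open>Integration over the whole space\<close>

lemma integrable_lborel_compact_support:
  fixes g :: "'a::euclidean_space \<Rightarrow> real"
  assumes "continuous_on UNIV g" and "compact K" and "\<And>x. x \<notin> K \<Longrightarrow> g x = 0"
  shows "integrable lborel g"
proof -
  have "integrable lborel (\<lambda>x. indicator K x *\<^sub>R g x)"
    using assms(2) continuous_on_subset[OF assms(1)] by (intro borel_integrable_compact) auto
  moreover have "(\<lambda>x. indicator K x *\<^sub>R g x) = g"
  proof
    show "indicator K x *\<^sub>R g x = g x" for x
      using assms(3)[of x] by (cases "x \<in> K") auto
  qed
  ultimately show ?thesis by simp
qed

lemma integral_cbox_eq_lborel:
  fixes g :: "'a::euclidean_space \<Rightarrow> real"
  assumes "continuous_on UNIV g" and "\<And>x. x \<notin> cbox a b \<Longrightarrow> g x = 0"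
  shows "integral (cbox a b) g = (LINT x|lborel. g x)"
proof -
  have "integral UNIV g = integral UNIV (\<lambda>x. if x \<in> cbox a b then g x else 0)"
    using assms(2) by (intro arg_cong[where f = "integral UNIV"]) auto
  then show ?thesis
    using integral_lborel[OF integrable_lborel_compact_support[OF assms(1) compact_cbox assms(2)]]
    by (simp add: integral_restrict_UNIV)
qed

lemma integral_lborel_affine:
  fixes g :: "'a::euclidean_space \<Rightarrow> real"
  assumes "continuous_on UNIV g" and "r > 0"
  shows "(LINT z|lborel. g z) = (LINT y|lborel. r ^ DIM('a) * g (x + r *\<^sub>R y))"
proof -
  have [measurable]: "g \<in> borel_measurable borel"
    using assms(1) by (simp add: borel_measurable_continuous_onI)
  have "(LINT z|lborel. g z) = (LINT z|density (distr lborel borel (\<lambda>y. x + r *\<^sub>R y)) (\<lambda>_. ennreal (\<bar>r\<bar> ^ DIM('a))). g z)"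
    using lborel_affine[of r x] assms(2) by simp
  also have "\<dots> = (LINT y|lborel. r ^ DIM('a) * g (x + r *\<^sub>R y))"
    using assms(2) by (subst integral_density) (auto simp: integral_distr)
  finally show ?thesis .
qed

lemma integral_lborel_pos:
  fixes g :: "'a::euclidean_space \<Rightarrow> real"
  assumes cont: "continuous_on UNIV g" and int: "integrable lborel g"
    and nonneg: "\<And>x. g x \<ge> 0" and pos: "g a > 0"
  shows "(LINT x|lborel. g x) > 0"
proof -
  obtain d where d: "d > 0" "\<And>y. dist y a < d \<Longrightarrow> dist (g y) (g a) < g a / 2"
    using cont pos unfolding continuous_on_iff by (metis UNIV_I half_gt_zero)
  have "0 < g a / 2 * measure lborel (ball a d)"
    using pos d(1) content_ball_pos[of d a] by simp
  also have "\<dots> = (LINT x|lborel. g a / 2 * indicator (ball a d) x)"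
    by simp
  also have "\<dots> \<le> (LINT x|lborel. g x)"
  proof (rule integral_mono)
    show "integrable lborel (\<lambda>x. g a / 2 * indicator (ball a d) x)"
      using emeasure_lborel_ball_finite[of a d] by (intro integrable_mult_right) simp
    show "g a / 2 * indicator (ball a d) x \<le> g x" for x
    proof (cases "x \<in> ball a d")
      case True
      then have "dist (g x) (g a) < g a / 2" using d(2)[of x] by (simp add: dist_commute)
      then have "g a / 2 \<le> g x" unfolding dist_real_def by linarith
      then show ?thesis using True by simp
    qed (simp add: nonneg)
  qed (rule int)
  finally show ?thesis .
qed

section \<open>Weak solutions\<close>

lemma test_function_continuous:
  assumes "test_function \<Omega> \<phi>"
  shows "continuous_on UNIV \<phi>" and "continuous_on UNIV (laplacian \<phi>)"
proof -
  have C: "Ck_on k \<phi> UNIV" for k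
    using assms by (simp add: test_function_def)
  show "continuous_on UNIV \<phi>" using C[of 0] by simp
  show "continuous_on UNIV (laplacian \<phi>)"
    unfolding laplacian_def[abs_def] using C[of "Suc (Suc 0)"]
    by (intro continuous_on_sum) simp
qed

text \<open>
  The complement of the support is open, so all derivatives vanish there.
\<close>

lemma laplacian_eq_0:
  assumes "x \<notin> closure {x. \<phi> x \<noteq> 0}"
  shows "laplacian \<phi> x = 0"
proof -
  define V where "V = - closure {x. \<phi> x \<noteq> 0}"
  have V: "open V" "x \<in> V"
    using assms by (auto simp: V_def)
  have zero: "\<phi> y = 0" if "y \<in> V" for y
    using closure_subset[of "{x. \<phi> x \<noteq> 0}"] that by (auto simp: V_def)
  have 1: "frechet_derivative \<phi> (at y) = (\<lambda>v. 0)" if "y \<in> V" for y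
  proof -
    have "(\<phi> has_derivative (\<lambda>v. 0)) (at y)"
      by (rule has_derivative_transform_within_open[OF has_derivative_const[of 0] V(1) that])
        (simp add: zero)
    then show ?thesis by (rule frechet_derivative_at[symmetric])
  qed
  have "frechet_derivative (\<lambda>y. frechet_derivative \<phi> (at y) b) (at x) = (\<lambda>v. 0)" for b
  proof -
    have "((\<lambda>y. frechet_derivative \<phi> (at y) b) has_derivative (\<lambda>v. 0)) (at x)"
      by (rule has_derivative_transform_within_open[OF has_derivative_const[of 0] V])
        (simp add: 1)
    then show ?thesis by (rule frechet_derivative_at[symmetric])
  qed
  then show ?thesis by (simp add: laplacian_def)
qed

lemma
  assumes "test_function \<Omega> \<phi>" and "continuous_on UNIV w"
  shows integrable_mult_test_function: "integrable lborel (\<lambda>x. w x * \<phi> x)"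
    and integrable_mult_laplacian: "integrable lborel (\<lambda>x. w x * laplacian \<phi> x)"
proof -
  have "compact (closure {x. \<phi> x \<noteq> 0})" "{x. \<phi> x \<noteq> 0} \<subseteq> closure {x. \<phi> x \<noteq> 0}"
    using assms(1) closure_subset[of "{x. \<phi> x \<noteq> 0}"]
    by (simp_all add: test_function_def del: compact_closure)
  moreover have "\<And>x. x \<notin> closure {x. \<phi> x \<noteq> 0} \<Longrightarrow> laplacian \<phi> x = 0"
    by (rule laplacian_eq_0)
  ultimately show "integrable lborel (\<lambda>x. w x * \<phi> x)" "integrable lborel (\<lambda>x. w x * laplacian \<phi> x)"
    using test_function_continuous[OF assms(1)] assms(2)
    by (auto intro!: integrable_lborel_compact_support[where K = "closure {x. \<phi> x \<noteq> 0}"]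
        continuous_on_mult)
qed

text \<open>
  Test functions live inside \<open>\<Omega>\<close>, so the domain of integration can be dropped. This makes solutions on
  different domains comparable.
\<close>

lemma weak_solution_iff:
  "weak_solution f \<Omega> u \<longleftrightarrow>
     (\<forall>\<phi>. test_function \<Omega> \<phi> \<longrightarrow>
        (LINT x|lborel. u x * laplacian \<phi> x) = (LINT x|lborel. f (u x) * \<phi> x))"
proof -
  have "(LINT x:\<Omega>|lborel. u x * laplacian \<phi> x) = (LINT x|lborel. u x * laplacian \<phi> x)"
    "(LINT x:\<Omega>|lborel. f (u x) * \<phi> x) = (LINT x|lborel. f (u x) * \<phi> x)"
    if "test_function \<Omega> \<phi>" for \<phi>
  proof -
    have "closure {x. \<phi> x \<noteq> 0} \<subseteq> \<Omega>"
      using that by (simp add: test_function_def)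
    then have "x \<notin> \<Omega> \<Longrightarrow> \<phi> x = 0 \<and> laplacian \<phi> x = 0" for x
      using closure_subset[of "{x. \<phi> x \<noteq> 0}"] laplacian_eq_0[of x \<phi>] by blast
    then show "(LINT x:\<Omega>|lborel. u x * laplacian \<phi> x) = (LINT x|lborel. u x * laplacian \<phi> x)"
      "(LINT x:\<Omega>|lborel. f (u x) * \<phi> x) = (LINT x|lborel. f (u x) * \<phi> x)"
      unfolding set_lebesgue_integral_def
      by (auto intro!: Bochner_Integration.integral_cong simp: indicator_def)
  qed
  then show ?thesis by (auto simp: weak_solution_def)
qed

lemma weak_solution_mono:
  "weak_solution f \<Omega> u \<Longrightarrow> \<Omega>' \<subseteq> \<Omega> \<Longrightarrow> weak_solution f \<Omega>' u"
  by (auto simp: weak_solution_iff test_function_def)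

text \<open>
  The reflected nonlinearity again satisfies the structural assumptions, so every one-sided estimate
  below yields its mirror image.
\<close>

lemma weak_solution_uminus:
  "weak_solution f \<Omega> u \<Longrightarrow> weak_solution (\<lambda>t. - f (- t)) \<Omega> (\<lambda>x. - u x)"
  by (simp add: weak_solution_iff)

section \<open>Mean value inequalities\<close>

text \<open>
  The masses are those of the radius-one profiles at the origin; by scaling they determine the integrals
  for all centres and radii. The argument only carries the type, hence the dimension.
\<close>

definition kern_mass :: "'a::euclidean_space itself \<Rightarrow> real" where
  "kern_mass _ = (LINT y|lborel. kern (0::'a) 1 y)"

definition bump_mass :: "'a::euclidean_space itself \<Rightarrow> real" where
  "bump_mass _ = (LINT y|lborel. bump (0::'a) 1 y)"

definition average :: "('a::euclidean_space \<Rightarrow> real) \<Rightarrow> 'a \<Rightarrow> real \<Rightarrow> real" where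
  "average v x r = (LINT z|lborel. v z * kern x r z)"

lemma flat_nonneg: "(\<And>s. s > 0 \<Longrightarrow> poly p s \<ge> 0) \<Longrightarrow> flat p t \<ge> 0"
  by (simp add: flat_def)

lemma kern_nonneg: "r > 0 \<Longrightarrow> kern x r z \<ge> 0"
  unfolding kern_def by (auto intro!: divide_nonneg_pos flat_nonneg simp: flat_deriv_def)

lemma bump_nonneg: "r > 0 \<Longrightarrow> bump x r z \<ge> 0"
  unfolding bump_def by (auto intro!: mult_nonneg_nonneg divide_nonneg_pos flat_nonneg)

lemma kern_eq_0: "r > 0 \<Longrightarrow> z \<notin> cball x r \<Longrightarrow> kern x r z = 0"
  by (simp add: kern_def flat_cap_eq_0)

lemma bump_eq_0: "r > 0 \<Longrightarrow> z \<notin> cball x r \<Longrightarrow> bump x r z = 0"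
  by (simp add: bump_def flat_cap_eq_0)

lemma continuous_on_kern [continuous_intros]: "continuous_on S (kern x r)"
  unfolding kern_def[abs_def] divide_inverse by (intro continuous_intros)

lemma continuous_on_bump [continuous_intros]: "continuous_on S (bump x r)"
  unfolding bump_def[abs_def] by (intro continuous_intros)

lemma integrable_mult_kern:
  "continuous_on UNIV v \<Longrightarrow> r > 0 \<Longrightarrow> integrable lborel (\<lambda>z. v z * kern x r z)"
  by (rule integrable_lborel_compact_support[of _ "cball x r"])
    (auto intro!: continuous_intros simp: kern_eq_0)

lemma integrable_mult_bump:
  "continuous_on UNIV v \<Longrightarrow> r > 0 \<Longrightarrow> integrable lborel (\<lambda>z. v z * bump x r z)"
  by (rule integrable_lborel_compact_support[of _ "cball x r"])
    (auto intro!: continuous_intros simp: bump_eq_0)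

lemma integrable_kern: "r > 0 \<Longrightarrow> integrable lborel (kern x r)"
  using integrable_mult_kern[of "\<lambda>_. 1"] by simp

lemma integrable_bump: "r > 0 \<Longrightarrow> integrable lborel (bump x r)"
  using integrable_mult_bump[of "\<lambda>_. 1"] by simp

lemma cap_rescale: "r > 0 \<Longrightarrow> cap x r (x + r *\<^sub>R y) = cap 0 1 y"
  by (simp add: cap_def power2_eq_square field_simps)

lemma integral_kern: "r > 0 \<Longrightarrow> (LINT z|lborel. kern (x::'a) r z) = kern_mass TYPE('a::euclidean_space)"
  by (subst integral_lborel_affine[of _ r x])
    (auto intro!: continuous_intros Bochner_Integration.integral_cong
      simp: kern_mass_def kern_def cap_rescale)

lemma integral_bump: "r > 0 \<Longrightarrow> (LINT z|lborel. bump (x::'a) r z) = r * bump_mass TYPE('a::euclidean_space)"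
  by (subst integral_lborel_affine[of _ r x])
    (auto intro!: continuous_intros Bochner_Integration.integral_cong
      simp: bump_mass_def bump_def cap_rescale)

lemma kern_mass_pos: "kern_mass TYPE('a::euclidean_space) > 0"
  unfolding kern_mass_def
proof (rule integral_lborel_pos[of _ 0])
  show "0 < kern (0::'a) 1 0"
    by (simp add: kern_def cap_def flat_def flat_deriv_def)
qed (auto intro!: continuous_intros integrable_kern kern_nonneg)

lemma bump_mass_pos: "bump_mass TYPE('a::euclidean_space) > 0"
  unfolding bump_mass_def
proof (rule integral_lborel_pos[of _ 0])
  show "0 < bump (0::'a) 1 0"
    by (simp add: bump_def cap_def flat_def)
qed (auto intro!: continuous_intros integrable_bump bump_nonneg)

lemma average_uminus: "average (\<lambda>z. - v z) x r = - average v x r"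
  by (simp add: average_def)

lemma average_ge:
  fixes x :: "'a::euclidean_space"
  assumes "continuous_on UNIV v" and "r > 0" and "\<And>z. z \<in> cball x r \<Longrightarrow> m \<le> v z"
  shows "m * kern_mass TYPE('a) \<le> average v x r"
proof -
  have "m * kern_mass TYPE('a) = (LINT z|lborel. m * kern x r z)"
    using assms(2) by (simp add: integral_kern)
  also have "\<dots> \<le> average v x r"
    unfolding average_def
  proof (rule integral_mono)
    show "m * kern x r z \<le> v z * kern x r z" for z
      using assms(3)[of z] kern_nonneg[OF assms(2), of x z] kern_eq_0[OF assms(2), of z x]
      by (cases "z \<in> cball x r") (auto intro: mult_right_mono)
  qed (use assms in \<open>auto intro!: integrable_mult_kern integrable_kern\<close>)
  finally show ?thesis .
qed

text \<open>
  Only the kernel depends on the radius, so \<open>v\<close> need not be differentiable: the derivative falls on the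
  kernel and turns it into the Laplacian of a test function, where the weak equation can be applied.
\<close>

lemma average_has_derivative:
  assumes v: "continuous_on UNIV v" and r: "r > 0"
  shows "(average v x has_real_derivative (LINT z|lborel. v z * laplacian (bump x r) z)) (at r)"
proof -
  obtain a b where box: "cball x (2 * r) \<subseteq> cbox a b"
    using bounded_subset_cbox_symmetric[OF bounded_cball] by blast
  \<comment> \<open>A neighbourhood of \<open>r\<close> on which all the kernels are supported in one fixed box.\<close>
  let ?U = "{0<..<2 * r}"
  have zero: "kern x s z = 0" "kern_deriv x s z = 0" if "z \<notin> cbox a b" "s \<in> ?U" for s z
  proof -
    have "s \<le> dist x z" using that box by (force simp: subset_iff)
    then show "kern x s z = 0" "kern_deriv x s z = 0"
      using that by (simp_all add: kern_def kern_deriv_def flat_cap_eq_0)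
  qed
  have cont: "continuous_on UNIV (\<lambda>z. v z * kern_deriv x r z)"
    unfolding kern_deriv_def[abs_def] divide_inverse using v by (intro continuous_intros)
  have "((\<lambda>s. integral (cbox a b) (\<lambda>z. v z * kern x s z)) has_field_derivative
      integral (cbox a b) (\<lambda>z. v z * kern_deriv x r z)) (at r within ?U)"
  proof (rule leibniz_rule_field_derivative)
    show "((\<lambda>s. v z * kern x s z) has_field_derivative v z * kern_deriv x s z) (at s within ?U)"
      if "s \<in> ?U" for s z
      using that by (intro DERIV_cmult kern_has_derivative) simp
    show "(\<lambda>z. v z * kern x s z) integrable_on cbox a b" for s
      using v by (intro integrable_continuous continuous_intros) (auto intro: continuous_on_subset)
    have "continuous_on (?U \<times> cbox a b) (\<lambda>p. v (snd p))"
      by (rule continuous_on_compose2[OF v]) (auto intro: continuous_intros)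
    then show "continuous_on (?U \<times> cbox a b) (\<lambda>(s, z). v z * kern_deriv x s z)"
      unfolding kern_deriv_def cap_def split_beta
      by (intro continuous_intros) auto
  qed (use r in auto)
  moreover have "integral (cbox a b) (\<lambda>z. v z * kern_deriv x r z) = (LINT z|lborel. v z * laplacian (bump x r) z)"
    using r by (subst integral_cbox_eq_lborel[OF cont]) (simp_all add: zero laplacian_bump)
  moreover have "integral (cbox a b) (\<lambda>z. v z * kern x s z) = average v x s" if "s \<in> ?U" for s
    unfolding average_def using v that by (intro integral_cbox_eq_lborel continuous_intros) (simp_all add: zero)
  ultimately show ?thesis
    using r by (simp add: at_within_open[of r ?U])
      (auto elim!: DERIV_cong_ev[THEN iffD1, rotated 3] simp: eventually_nhds intro!: exI[of _ ?U])
qed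

text \<open>
  For a weak solution, \<open>d/dr\<close> of the average is \<open>\<integral> f(v) bump\<close>, which is at least \<open>c r\<close> times the mass of
  the bump. Integrating from \<open>0\<close>, where the average tends to \<open>v x\<close> times the mass of the kernel, gives
  the claim. This replaces the Green function and the regularity theory of the Laplacian.
\<close>

lemma average_ge_of_weak_solution:
  fixes x :: "'a::euclidean_space"
  assumes f: "continuous_on UNIV f" and v: "continuous_on UNIV v"
    and sol: "weak_solution f \<Omega> v" and R: "R > 0" "cball x R \<subseteq> \<Omega>"
    and c: "\<And>z. z \<in> cball x R \<Longrightarrow> c \<le> f (v z)"
  shows "v x * kern_mass TYPE('a) + c * bump_mass TYPE('a) * R\<^sup>2 / 2 \<le> average v x R"
proof -
  let ?N = "kern_mass TYPE('a)" and ?k = "bump_mass TYPE('a)"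
  \<comment> \<open>The claim says that \<open>g R\<close> is at least the limit of \<open>g\<close> at \<open>0\<close>, so it suffices that \<open>g\<close> is nondecreasing.\<close>
  define g where "g r = average v x r - c * ?k * r\<^sup>2 / 2" for r
  have fv: "continuous_on UNIV (\<lambda>z. f (v z))"
    by (rule continuous_on_compose2[OF f v]) simp
  have deriv: "\<exists>y. (g has_real_derivative y) (at r) \<and> 0 \<le> y" if r: "0 < r" "r \<le> R" for r
  proof -
    have test: "test_function \<Omega> (bump x r)"
      using r R(2) by (intro test_function_bump) auto
    have "c * (r * ?k) = (LINT z|lborel. c * bump x r z)"
      using r by (simp add: integral_bump)
    also have "\<dots> \<le> (LINT z|lborel. f (v z) * bump x r z)"
    proof (rule integral_mono)
      show "c * bump x r z \<le> f (v z) * bump x r z" for z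
        using c[of z] r bump_nonneg[OF r(1), of x z] bump_eq_0[OF r(1), of z x]
        by (cases "z \<in> cball x r") (auto intro: mult_right_mono)
    qed (use r fv in \<open>auto intro!: integrable_mult_bump integrable_bump\<close>)
    also have "\<dots> = (LINT z|lborel. v z * laplacian (bump x r) z)"
      using sol test by (simp add: weak_solution_iff)
    finally have nonneg: "0 \<le> (LINT z|lborel. v z * laplacian (bump x r) z) - c * ?k * r"
      by (simp add: algebra_simps)
    have square: "((\<lambda>r. c * ?k * r\<^sup>2 / 2) has_real_derivative c * ?k * r) (at r)"
      by (auto intro!: derivative_eq_intros)
    have g': "(g has_real_derivative (LINT z|lborel. v z * laplacian (bump x r) z) - c * ?k * r) (at r)"
      unfolding g_def[abs_def] by (rule DERIV_diff[OF average_has_derivative[OF v r(1)] square])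
    show ?thesis by (rule exI, rule conjI[OF g' nonneg])
  qed
  have mono: "g s \<le> g R" if "0 < s" "s \<le> R" for s
    by (rule DERIV_nonneg_imp_nondecreasing[OF that(2)], rule deriv) (use that(1) in simp_all)
  have "v x * ?N \<le> g R + e" if e: "e > 0" for e
  proof -
    define e' where "e' = e / ?N"
    have e': "e' > 0" using e kern_mass_pos[where 'a = 'a] by (simp add: e'_def)
    obtain d where d: "d > 0" "\<And>y. dist y x < d \<Longrightarrow> dist (v y) (v x) < e'"
      using v e' unfolding continuous_on_iff by (metis UNIV_I)
    have "(v x - e') * ?N - c * ?k * s\<^sup>2 / 2 \<le> g R" if s: "0 < s" "s < min d R" for s
    proof -
      have "(v x - e') * ?N \<le> average v x s"
      proof (rule average_ge[OF v s(1)])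
        fix z assume "z \<in> cball x s"
        then have "dist (v z) (v x) < e'" using d(2)[of z] s by (simp add: dist_commute)
        then show "v x - e' \<le> v z" unfolding dist_real_def by linarith
      qed
      then show ?thesis using mono[of s] s by (simp add: g_def)
    qed
    then have ev: "\<forall>\<^sub>F s in at_right 0. (v x - e') * ?N - c * ?k * s\<^sup>2 / 2 \<le> g R"
      using d(1) R(1) by (auto simp: eventually_at_right_field intro!: exI[of _ "min d R"])
    have "((\<lambda>s. (v x - e') * ?N - c * ?k * s\<^sup>2 / 2) \<longlongrightarrow> (v x - e') * ?N - c * ?k * 0\<^sup>2 / 2) (at_right 0)"
      by (intro tendsto_intros) simp_all
    from tendsto_upperbound[OF this ev] have "v x * ?N - e' * ?N \<le> g R"
      by (simp add: left_diff_distrib)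
    moreover have "e' * ?N = e"
      using kern_mass_pos[where 'a = 'a] by (simp add: e'_def)
    ultimately show ?thesis by simp
  qed
  then have "v x * ?N \<le> g R" by (rule field_le_epsilon)
  then show ?thesis by (simp add: g_def)
qed

lemma average_le_of_weak_solution:
  fixes x :: "'a::euclidean_space"
  assumes f: "continuous_on UNIV f" and v: "continuous_on UNIV v"
    and sol: "weak_solution f \<Omega> v" and R: "R > 0" "cball x R \<subseteq> \<Omega>"
    and c: "\<And>z. z \<in> cball x R \<Longrightarrow> f (v z) \<le> c"
  shows "average v x R \<le> v x * kern_mass TYPE('a) + c * bump_mass TYPE('a) * R\<^sup>2 / 2"
proof -
  have "- v x * kern_mass TYPE('a) + (- c) * bump_mass TYPE('a) * R\<^sup>2 / 2 \<le> average (\<lambda>z. - v z) x R"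
  proof (rule average_ge_of_weak_solution[OF _ _ weak_solution_uminus[OF sol] R])
    show "continuous_on UNIV (\<lambda>t. - f (- t))"
      by (intro continuous_intros continuous_on_compose2[OF f]) auto
  qed (use v c in \<open>auto intro: continuous_intros\<close>)
  then show ?thesis by (simp add: average_uminus)
qed

section \<open>Equicontinuity of bounded solutions\<close>

lemma kern_shift: "kern x r z = kern 0 r (z - x)"
  by (simp add: kern_def cap_def)

text \<open>
  The kernel is uniformly continuous with compact support. The unit slack in the radius \<open>r + 1\<close> below lets
  one ball about \<open>x\<close> contain the supports of both kernels.
\<close>

lemma kern_integral_dist_small:
  fixes r e :: real
  assumes r: "r > 0" and e: "e > 0"
  shows "\<exists>d>0. \<forall>x y::'a::euclidean_space. dist x y < d \<longrightarrow>
     (LINT z|lborel. \<bar>kern x r z - kern y r z\<bar>) \<le> e"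
proof -
  define V where "V = measure lborel (cball (0::'a) (r + 1))"
  have V: "V > 0" unfolding V_def using r content_cball_pos[of "r + 1" "0::'a"] by simp
  have "uniformly_continuous_on (cball (0::'a) (r + 2)) (kern 0 r)"
    by (intro compact_uniformly_continuous continuous_on_kern compact_cball)
  then obtain d where d: "d > 0" and unif: "\<And>s t::'a. s \<in> cball 0 (r + 2) \<Longrightarrow> t \<in> cball 0 (r + 2) \<Longrightarrow>
      dist t s < d \<Longrightarrow> dist (kern 0 r t) (kern 0 r s) < e / V"
    unfolding uniformly_continuous_on_def using e V by (metis divide_pos_pos)
  have "(LINT z|lborel. \<bar>kern x r z - kern y r z\<bar>) \<le> e" if xy: "dist x y < min d 1" for x y :: 'a
  proof -
    have "(LINT z|lborel. \<bar>kern x r z - kern y r z\<bar>) \<le> (LINT z|lborel. e / V * indicator (cball x (r + 1)) z)"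
    proof (rule integral_mono)
      show "integrable lborel (\<lambda>z. \<bar>kern x r z - kern y r z\<bar>)"
        using r by (intro integrable_abs Bochner_Integration.integrable_diff integrable_kern)
      show "integrable lborel (\<lambda>z. e / V * indicator (cball x (r + 1)) z)"
        using emeasure_lborel_cball_finite[of x "r + 1"] by (intro integrable_mult_right) simp
      show "\<bar>kern x r z - kern y r z\<bar> \<le> e / V * indicator (cball x (r + 1)) z" for z
      proof (cases "z \<in> cball x (r + 1)")
        case True
        have "dist z y \<le> dist z x + dist x y" by (rule dist_triangle)
        then have "z - x \<in> cball 0 (r + 2)" "z - y \<in> cball 0 (r + 2)" "dist (z - x) (z - y) < d"
          using True xy by (auto simp: dist_norm norm_minus_commute)
        from unif[OF this(2,1,3)] show ?thesis
          using True by (simp add: kern_shift[of x] kern_shift[of y] dist_real_def)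
      next
        case False
        moreover have "dist x z \<le> dist x y + dist y z" by (rule dist_triangle)
        ultimately show ?thesis
          using xy r by (simp add: kern_eq_0)
      qed
    qed
    also have "\<dots> = e"
    proof -
      have "measure lborel (cball x (r + 1)) = V"
        using r by (simp add: V_def content_cball)
      then show ?thesis using V by simp
    qed
    finally show ?thesis .
  qed
  then show ?thesis using d by (intro exI[of _ "min d 1"]) auto
qed

text \<open>
  The modulus \<open>d\<close> depends only on \<open>f\<close>, \<open>M\<close> and \<open>e\<close>. Where \<open>|f(u)| \<le> G\<close>, the mean value inequalities put
  \<open>u\<close> within \<open>O(G r\<^sup>2)\<close> of its average of radius \<open>r\<close>, uniformly in the solution and its domain, provided the
  unit ball fits into the domain. After \<open>r\<close> has been fixed, the averages are equicontinuous because the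
  kernel depends continuously on its centre.
\<close>

lemma bounded_weak_solutions_equicontinuous:
  fixes f :: "real \<Rightarrow> real" and M e :: real
  assumes f: "continuous_on UNIV f" and e: "e > 0"
  obtains d where "d > 0"
    and "\<And>(u::'a::euclidean_space \<Rightarrow> real) \<Omega> x y. \<lbrakk>continuous_on UNIV u; \<And>z. \<bar>u z\<bar> \<le> M; weak_solution f \<Omega> u;
       cball x 1 \<subseteq> \<Omega>; cball y 1 \<subseteq> \<Omega>; dist x y < d\<rbrakk> \<Longrightarrow> \<bar>u x - u y\<bar> < e"
proof -
  let ?N = "kern_mass TYPE('a)" and ?k = "bump_mass TYPE('a)"
  note N = kern_mass_pos[where 'a = 'a] and k = bump_mass_pos[where 'a = 'a]
  have "bounded (f ` {-M..M})"
    by (intro compact_imp_bounded compact_continuous_image continuous_on_subset[OF f]) auto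
  then obtain G where G: "G > 0" "\<And>t. \<bar>t\<bar> \<le> M \<Longrightarrow> \<bar>f t\<bar> \<le> G"
    unfolding bounded_pos by (auto simp: abs_le_iff)
  \<comment> \<open>Both points contribute an error \<open>G ?k r\<^sup>2 / 2\<close>; together they may use up half of \<open>e ?N\<close>.\<close>
  define r where "r = min 1 (e * ?N / (2 * G * ?k))"
  have r: "0 < r" "r \<le> 1" using e N k G(1) by (auto simp: r_def)
  have "G * ?k * r\<^sup>2 \<le> G * ?k * r"
    using r k G(1) by (intro mult_left_mono) (auto simp: power2_eq_square mult_le_one)
  also have "\<dots> \<le> e * ?N / 2"
  proof -
    have "G * ?k * r \<le> G * ?k * (e * ?N / (2 * G * ?k))"
      using k G(1) by (intro mult_left_mono) (auto simp: r_def)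
    then show ?thesis using k G(1) by simp
  qed
  finally have small: "G * ?k * r\<^sup>2 \<le> e * ?N / 2" .
  define e' where "e' = e * ?N / (4 * (\<bar>M\<bar> + 1))"
  have e': "e' > 0" using e N by (simp add: e'_def)
  obtain d where d: "d > 0"
    "\<And>x y::'a. dist x y < d \<Longrightarrow> (LINT z|lborel. \<bar>kern x r z - kern y r z\<bar>) \<le> e'"
    using kern_integral_dist_small[OF r(1) e'] by blast
  show thesis
  proof (rule that[OF d(1)])
    fix u :: "'a \<Rightarrow> real" and \<Omega> x y
    assume u: "continuous_on UNIV u" and M: "\<And>z. \<bar>u z\<bar> \<le> M" and sol: "weak_solution f \<Omega> u"
      and sub: "cball x 1 \<subseteq> \<Omega>" "cball y 1 \<subseteq> \<Omega>" and xy: "dist x y < d"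
    have near: "\<bar>average u p r - u p * ?N\<bar> \<le> G * ?k * r\<^sup>2 / 2" if "cball p 1 \<subseteq> \<Omega>" for p
    proof -
      have "cball p r \<subseteq> \<Omega>" using that r(2) by auto
      note sol' = f u sol r(1) this
      have "\<bar>f (u z)\<bar> \<le> G" for z by (rule G(2)[OF M])
      then have "- G \<le> f (u z)" "f (u z) \<le> G" for z by (simp_all add: abs_le_iff minus_le_iff)
      from average_ge_of_weak_solution[OF sol' this(1)] average_le_of_weak_solution[OF sol' this(2)]
      show ?thesis unfolding abs_le_iff by linarith
    qed
    have "\<bar>average u x r - average u y r\<bar> = \<bar>LINT z|lborel. u z * (kern x r z - kern y r z)\<bar>"
      unfolding average_def using u r(1)
      by (subst Bochner_Integration.integral_diff[symmetric])
        (auto intro!: integrable_mult_kern simp: right_diff_distrib)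
    also have "\<dots> \<le> (LINT z|lborel. \<bar>u z * (kern x r z - kern y r z)\<bar>)"
      by (rule integral_abs_bound)
    also have "\<dots> \<le> (LINT z|lborel. M * \<bar>kern x r z - kern y r z\<bar>)"
    proof (rule integral_mono)
      show "integrable lborel (\<lambda>z. \<bar>u z * (kern x r z - kern y r z)\<bar>)"
        unfolding right_diff_distrib using u r(1)
        by (intro integrable_abs Bochner_Integration.integrable_diff integrable_mult_kern)
      show "integrable lborel (\<lambda>z. M * \<bar>kern x r z - kern y r z\<bar>)"
        using r(1) by (intro integrable_mult_right integrable_abs Bochner_Integration.integrable_diff integrable_kern)
    qed (auto simp: abs_mult intro!: mult_right_mono M)
    also have "\<dots> \<le> M * e'"
      using d(2)[OF xy] M[of 0] by (auto intro!: mult_left_mono)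
    also have "\<dots> < e * ?N / 2"
    proof -
      have "M * e' \<le> (\<bar>M\<bar> + 1) * e'" using e' by (intro mult_right_mono) auto
      also have "\<dots> = e * ?N / 4" by (simp add: e'_def field_simps)
      also have "\<dots> < e * ?N / 2" using e N by simp
      finally show ?thesis .
    qed
    finally have "\<bar>u x * ?N - u y * ?N\<bar> < e * ?N"
      using near[OF sub(1)] near[OF sub(2)] small by (simp only: abs_less_iff abs_le_iff) linarith
    then have "\<bar>u x - u y\<bar> * ?N < e * ?N"
      using N by (simp add: left_diff_distrib[symmetric] abs_mult)
    then show "\<bar>u x - u y\<bar> < e" using N by simp
  qed
qed

section \<open>A universal bound for entire bounded solutions\<close>

text \<open>
  A maximum principle on the whole space. The supremum \<open>S\<close> need not be attained, but if \<open>S > m\<close>, then around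
  a point \<open>p\<close> where \<open>u\<close> nearly equals \<open>S\<close> uniform continuity keeps \<open>u\<close> above \<open>m\<close> on a ball whose radius \<open>r\<close>
  does not depend on \<open>p\<close>. There \<open>f(u)\<close> is bounded below by a positive constant, so the average over the
  ball exceeds the value at the centre by a fixed amount, and thereby exceeds \<open>S\<close>.
\<close>

lemma entire_bounded_solution_le:
  fixes u :: "'a::euclidean_space \<Rightarrow> real"
  assumes f: "continuous_on UNIV f" and u: "continuous_on UNIV u" and M: "\<And>z. \<bar>u z\<bar> \<le> M"
    and sol: "weak_solution f UNIV u" and pos: "\<And>t. m \<le> t \<Longrightarrow> 0 < f t"
  shows "u x \<le> m"
proof (rule ccontr)
  let ?N = "kern_mass TYPE('a)" and ?k = "bump_mass TYPE('a)"
  note N = kern_mass_pos[where 'a = 'a] and k = bump_mass_pos[where 'a = 'a]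
  assume "\<not> u x \<le> m"
  define S where "S = (SUP z. u z)"
  have bdd: "bdd_above (range u)"
    using M by (intro bdd_aboveI[of _ M]) (auto simp: abs_le_iff)
  have le_S: "u z \<le> S" for z
    unfolding S_def by (rule cSUP_upper[OF _ bdd]) simp
  have S: "m < S" using \<open>\<not> u x \<le> m\<close> le_S[of x] by simp
  have "{m..S} \<noteq> {}" using S by simp
  then obtain t0 where t0: "t0 \<in> {m..S}" "\<And>t. t \<in> {m..S} \<Longrightarrow> f t0 \<le> f t"
    using continuous_attains_inf[of "{m..S}" f] continuous_on_subset[OF f] by blast
  define c where "c = f t0"
  have c: "0 < c" "\<And>t. m \<le> t \<Longrightarrow> t \<le> S \<Longrightarrow> c \<le> f t"
    using t0 pos by (auto simp: c_def)
  obtain d where d: "d > 0" "\<And>x y. dist x y < d \<Longrightarrow> \<bar>u x - u y\<bar> < (S - m) / 2"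
    using bounded_weak_solutions_equicontinuous[OF f, of "(S - m) / 2" M] S u M sol
    by (metis diff_gt_0_iff_gt half_gt_zero subset_UNIV)
  define r where "r = d / 2"
  have r: "r > 0" "r < d" using d(1) by (auto simp: r_def)
  \<comment> \<open>How close \<open>u p\<close> must be to \<open>S\<close>: the first bound keeps \<open>u \<ge> m\<close> on the ball, the second is the gain of the average.\<close>
  define b where "b = min ((S - m) / 2) (c * ?k * r\<^sup>2 / (2 * ?N))"
  have b: "b \<le> (S - m) / 2" "b \<le> c * ?k * r\<^sup>2 / (2 * ?N)"
    unfolding b_def by (rule min.cobounded1, rule min.cobounded2)
  have "b > 0" using S c(1) k N r by (simp add: b_def)
  then obtain p where p: "S - b < u p"
    using less_cSUP_iff[OF _ bdd, of "S - b"] by (auto simp: S_def)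
  have "u p * ?N + c * ?k * r\<^sup>2 / 2 \<le> average u p r"
  proof (rule average_ge_of_weak_solution[OF f u sol r(1)])
    fix z assume "z \<in> cball p r"
    then have "\<bar>u z - u p\<bar> < (S - m) / 2" using d(2)[of z p] r by (simp add: dist_commute)
    then have "u p < u z + (S - m) / 2" unfolding abs_less_iff by linarith
    then have "m \<le> u z" using p b(1) by (simp add: field_simps)
    then show "c \<le> f (u z)" using c(2) le_S by blast
  qed simp
  moreover have "average u p r \<le> S * ?N"
    using average_ge[of "\<lambda>z. - u z" r p "- S"] u r(1) le_S
    by (auto simp: average_uminus intro: continuous_intros)
  moreover have "S * ?N - c * ?k * r\<^sup>2 / 2 < u p * ?N"
  proof -
    have "S - c * ?k * r\<^sup>2 / (2 * ?N) < u p" using p b(2) by linarith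
    then have "(S - c * ?k * r\<^sup>2 / (2 * ?N)) * ?N < u p * ?N" using N by simp
    then show ?thesis using N by (simp add: left_diff_distrib)
  qed
  ultimately show False by linarith
qed

text \<open>
  The bound \<open>|C| + 1\<close> is crude but explicit: for \<open>|u| \<ge> 1\<close> the power of \<open>|u|\<close> dominates \<open>|u|\<close> itself.
\<close>

lemma coercive_positive:
  fixes f :: "real \<Rightarrow> real"
  assumes "\<epsilon> > 0" and coercive: "\<And>u. f u * u \<ge> - C + \<bar>u\<bar> powr (2 + \<epsilon>)"
  shows "\<bar>C\<bar> + 1 \<le> t \<Longrightarrow> 0 < f t" and "\<bar>C\<bar> + 1 \<le> t \<Longrightarrow> f (- t) < 0"
proof -
  have *: "0 < f u * u" if "\<bar>C\<bar> + 1 \<le> \<bar>u\<bar>" for u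
  proof -
    have "C < \<bar>u\<bar>" using that by linarith
    also have "\<bar>u\<bar> = \<bar>u\<bar> powr 1" by simp
    also have "\<dots> \<le> \<bar>u\<bar> powr (2 + \<epsilon>)" using that assms(1) by (intro powr_mono) auto
    finally show ?thesis using coercive[of u] by linarith
  qed
  show "0 < f t" if "\<bar>C\<bar> + 1 \<le> t" using *[of t] that by (auto simp: zero_less_mult_iff)
  show "f (- t) < 0" if "\<bar>C\<bar> + 1 \<le> t" using *[of "- t"] that by (auto simp: zero_less_mult_iff mult_less_0_iff)
qed

text \<open>
  The conclusion does not involve \<open>M\<close>: any two entire bounded solutions obey the same bound, which is what
  makes their set compact.
\<close>

lemma entire_bounded_solution_abs_le:
  fixes u :: "'a::euclidean_space \<Rightarrow> real"
  assumes f: "continuous_on UNIV f" and u: "continuous_on UNIV u" and M: "\<And>z. \<bar>u z\<bar> \<le> M"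
    and sol: "weak_solution f UNIV u"
    and "\<epsilon> > 0" and coercive: "\<And>u. f u * u \<ge> - C + \<bar>u\<bar> powr (2 + \<epsilon>)"
  shows "\<bar>u x\<bar> \<le> \<bar>C\<bar> + 1"
proof -
  note pos = coercive_positive[of \<epsilon> C f, OF assms(5,6)]
  have "u x \<le> \<bar>C\<bar> + 1"
    by (rule entire_bounded_solution_le[OF f u M sol pos(1)])
  moreover have "- u x \<le> \<bar>C\<bar> + 1"
  proof (rule entire_bounded_solution_le[OF _ _ _ weak_solution_uminus[OF sol]])
    show "continuous_on UNIV (\<lambda>t. - f (- t))"
      by (intro continuous_intros continuous_on_compose2[OF f]) auto
  qed (use u M pos(2) in \<open>auto intro: continuous_intros\<close>)
  ultimately show ?thesis by simp
qed

section \<open>Translation invariance\<close>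

text \<open>
  As an equivalence it transfers to \<open>frechet_derivative\<close> without differentiability assumptions.
\<close>

lemma has_derivative_shift_iff:
  "((\<lambda>x. g (x + h)) has_derivative D) (at x) \<longleftrightarrow> (g has_derivative D) (at (x + h))"
  for g :: "'a::real_normed_vector \<Rightarrow> 'b::real_normed_vector"
proof -
  have shift: "((\<lambda>x. k (x + c)) has_derivative D) (at y)" if "(k has_derivative D) (at (y + c))"
    for k :: "'a \<Rightarrow> 'b" and c y
    by (rule has_derivative_compose[where f = "\<lambda>x. x + c" and f' = "\<lambda>v. v", OF _ that])
      (auto intro!: derivative_eq_intros)
  show ?thesis
    using shift[of g x h] shift[of "\<lambda>x. g (x + h)" "x + h" "- h"] by auto
qed

lemma frechet_derivative_shift:
  "frechet_derivative (\<lambda>x. g (x + h)) (at x) = frechet_derivative g (at (x + h))"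
  by (simp add: frechet_derivative_def has_derivative_shift_iff)

lemma laplacian_shift: "laplacian (\<lambda>x. g (x + h)) x = laplacian g (x + h)"
proof -
  have "frechet_derivative (\<lambda>y. frechet_derivative (\<lambda>x. g (x + h)) (at y) b) (at x) =
      frechet_derivative (\<lambda>y. frechet_derivative g (at y) b) (at (x + h))" for b
    using frechet_derivative_shift[of "\<lambda>y. frechet_derivative g (at y) b" h x]
    by (simp add: frechet_derivative_shift)
  then show ?thesis by (simp add: laplacian_def)
qed

lemma Ck_on_shift: "Ck_on k g UNIV \<Longrightarrow> Ck_on k (\<lambda>x. g (x + h)) UNIV"
proof (induction k arbitrary: g)
  case 0
  then show ?case
    by (auto intro!: continuous_intros intro: continuous_on_compose2[of UNIV g])
next
  case (Suc k)
  show ?case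
    by (rule Ck_on_SucI[where D = "\<lambda>x. frechet_derivative g (at (x + h))"])
      (use Suc in \<open>auto simp: has_derivative_shift_iff frechet_derivative_works[symmetric]\<close>)
qed

lemma test_function_shift:
  assumes "test_function {x. x + h \<in> \<Omega>} \<phi>"
  shows "test_function \<Omega> (\<lambda>x. \<phi> (x + (- h)))"
proof -
  have "{x. \<phi> (x + (- h)) \<noteq> 0} = (+) h ` {x. \<phi> x \<noteq> 0}"
    by (force simp: image_iff intro: exI[of _ "_ - h"])
  then have "closure {x. \<phi> (x + (- h)) \<noteq> 0} = (+) h ` closure {x. \<phi> x \<noteq> 0}"
    by (simp add: closure_translation)
  moreover have "compact ((+) h ` closure {x. \<phi> x \<noteq> 0})"
    using assms unfolding test_function_def by (blast intro: compact_translation)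
  moreover have "(+) h ` closure {x. \<phi> x \<noteq> 0} \<subseteq> \<Omega>"
    using assms by (auto simp: test_function_def add.commute)
  moreover have "Ck_on k (\<lambda>x. \<phi> (x + (- h))) UNIV" for k
    using assms unfolding test_function_def by (blast intro: Ck_on_shift)
  ultimately show ?thesis unfolding test_function_def by simp
qed

lemma weak_solution_shift:
  assumes f: "continuous_on UNIV f" and u: "continuous_on UNIV u" and sol: "weak_solution f \<Omega> u"
  shows "weak_solution f {x. x + h \<in> \<Omega>} (\<lambda>x. u (x + h))"
  unfolding weak_solution_iff
proof (intro allI impI)
  fix \<phi> assume \<phi>: "test_function {x. x + h \<in> \<Omega>} \<phi>"
  let ?\<psi> = "\<lambda>x. \<phi> (x + (- h))"
  have test: "test_function \<Omega> ?\<psi>" by (rule test_function_shift[OF \<phi>])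
  have fu: "continuous_on UNIV (\<lambda>x. f (u x))"
    by (rule continuous_on_compose2[OF f u]) simp
  have shift: "(LINT x|lborel. g x) = (LINT x|lborel. g (x + h))"
    if "continuous_on UNIV g" for g :: "'a \<Rightarrow> real"
    using integral_lborel_affine[OF that, of 1 h] by (simp add: add.commute)
  have "(LINT x|lborel. u (x + h) * laplacian \<phi> x) = (LINT x|lborel. u x * laplacian ?\<psi> x)"
    by (subst shift[OF continuous_on_mult[OF u test_function_continuous(2)[OF test]]])
      (simp only: laplacian_shift add.assoc add.right_inverse add_0_right)
  also have "\<dots> = (LINT x|lborel. f (u x) * ?\<psi> x)"
    using sol test by (simp only: weak_solution_iff)
  also have "\<dots> = (LINT x|lborel. f (u (x + h)) * \<phi> x)"
    by (subst shift[OF continuous_on_mult[OF fu test_function_continuous(1)[OF test]]])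
      (simp only: add.assoc add.right_inverse add_0_right)
  finally show "(LINT x|lborel. u (x + h) * laplacian \<phi> x) = (LINT x|lborel. f (u (x + h)) * \<phi> x)" .
qed

lemma continuous_on_bcontfun: "continuous_on S (apply_bcontfun u)"
  by (rule continuous_on_apply_bcontfun)

lemma weak_solution_translate:
  assumes "continuous_on UNIV f" and "weak_solution f \<Omega> (apply_bcontfun u)"
  shows "weak_solution f {x. x + h \<in> \<Omega>} (apply_bcontfun (translate h u))"
proof -
  have "apply_bcontfun (translate h u) = (\<lambda>x. u (x + h))"
    by (rule ext) (rule apply_translate)
  then show ?thesis
    using weak_solution_shift[OF assms(1) continuous_on_bcontfun assms(2)] by simp
qed

lemma translate_complete_bounded_solutions:
  assumes f: "continuous_on UNIV f"
  shows "translate h ` complete_bounded_solutions f = complete_bounded_solutions f"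
proof -
  have sub: "translate k u \<in> complete_bounded_solutions f" if "u \<in> complete_bounded_solutions f" for k u
    using weak_solution_translate[OF f, of UNIV u k] that by (simp add: complete_bounded_solutions_def)
  have "u = translate h (translate (- h) u)" for u :: "'a \<Rightarrow>\<^sub>C real"
    by (rule bcontfun_eqI) (simp add: apply_translate)
  then show ?thesis using sub by blast
qed

section \<open>Limits of solutions on growing balls\<close>

text \<open>
  A test function sees only a compact set, on which \<open>v\<close> and \<open>f(v)\<close> are uniformly close to \<open>u\<close> and
  \<open>f(u)\<close> for a solution \<open>u\<close> on a ball containing that set.
\<close>

lemma weak_solution_approx:
  fixes v :: "'a::euclidean_space \<Rightarrow> real"
  assumes f: "continuous_on UNIV f" and v: "continuous_on UNIV v" "\<And>x. \<bar>v x\<bar> \<le> M"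
    and approx: "\<And>R K e. compact K \<Longrightarrow> e > 0 \<Longrightarrow> \<exists>u. continuous_on UNIV u \<and> (\<forall>x. \<bar>u x\<bar> \<le> M) \<and>
        weak_solution f (ball 0 R) u \<and> (\<forall>x\<in>K. \<bar>u x - v x\<bar> < e)"
  shows "weak_solution f UNIV v"
  unfolding weak_solution_iff
proof (intro allI impI)
  fix \<phi> :: "'a \<Rightarrow> real" assume \<phi>: "test_function UNIV \<phi>"
  define L where "L = closure {x. \<phi> x \<noteq> 0}"
  have L: "compact L" using \<phi> by (simp add: test_function_def L_def)
  have zero: "\<phi> x = 0" "laplacian \<phi> x = 0" if "x \<notin> L" for x
    using that closure_subset[of "{x. \<phi> x \<noteq> 0}"] laplacian_eq_0[of x \<phi>] by (auto simp: L_def)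
  obtain R where R: "L \<subseteq> ball 0 R"
    using compact_imp_bounded[OF L] bounded_subset_ballD by blast
  have test: "test_function (ball 0 R) \<phi>"
    using \<phi> R by (simp add: test_function_def L_def)
  let ?I = "(LINT x|lborel. v x * laplacian \<phi> x) - (LINT x|lborel. f (v x) * \<phi> x)"
  define A where "A = (LINT x|lborel. \<bar>laplacian \<phi> x\<bar>) + (LINT x|lborel. \<bar>\<phi> x\<bar>)"
  note int = integrable_mult_test_function[OF \<phi>] integrable_mult_laplacian[OF \<phi>]
  have A: "A \<ge> 0" unfolding A_def by (intro add_nonneg_nonneg integral_nonneg) auto
  have fcomp: "continuous_on UNIV (\<lambda>x. f (w x))" if "continuous_on UNIV w" for w :: "'a \<Rightarrow> real"
    by (rule continuous_on_compose2[OF f that]) simp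
  have diff: "\<bar>(LINT x|lborel. a x * \<eta> x) - (LINT x|lborel. b x * \<eta> x)\<bar> \<le> e * (LINT x|lborel. \<bar>\<eta> x\<bar>)"
    if "integrable lborel (\<lambda>x. a x * \<eta> x)" "integrable lborel (\<lambda>x. b x * \<eta> x)" "integrable lborel \<eta>"
      and close: "\<And>x. x \<in> L \<Longrightarrow> \<bar>a x - b x\<bar> \<le> e" "\<And>x. x \<notin> L \<Longrightarrow> \<eta> x = 0"
    for a b \<eta> :: "'a \<Rightarrow> real" and e
  proof -
    have "\<bar>(LINT x|lborel. a x * \<eta> x) - (LINT x|lborel. b x * \<eta> x)\<bar> =
        \<bar>LINT x|lborel. a x * \<eta> x - b x * \<eta> x\<bar>"
      using that(1,2) by simp
    also have "\<dots> \<le> (LINT x|lborel. \<bar>a x * \<eta> x - b x * \<eta> x\<bar>)"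
      by (rule integral_abs_bound)
    also have "\<dots> \<le> (LINT x|lborel. e * \<bar>\<eta> x\<bar>)"
    proof (rule integral_mono)
      show "\<bar>a x * \<eta> x - b x * \<eta> x\<bar> \<le> e * \<bar>\<eta> x\<bar>" for x
        using close[of x]
        by (cases "x \<in> L") (auto simp: left_diff_distrib[symmetric] abs_mult intro: mult_right_mono)
    qed (use that in auto)
    finally show ?thesis by simp
  qed
  have bound: "\<bar>?I\<bar> \<le> e * A" if e: "e > 0" for e
  proof -
    have "uniformly_continuous_on {-M..M} f"
      by (intro compact_uniformly_continuous continuous_on_subset[OF f]) auto
    then obtain d where d: "d > 0" "\<And>s t. \<lbrakk>s \<in> {-M..M}; t \<in> {-M..M}; dist t s < d\<rbrakk> \<Longrightarrow> dist (f t) (f s) < e"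
      unfolding uniformly_continuous_on_def using e by metis
    obtain u where u: "continuous_on UNIV u" "\<And>x. \<bar>u x\<bar> \<le> M" "weak_solution f (ball 0 R) u"
        "\<And>x. x \<in> L \<Longrightarrow> \<bar>u x - v x\<bar> < min d e"
      using approx[OF L, of "min d e" R] d(1) e by auto
    have "\<bar>(LINT x|lborel. v x * laplacian \<phi> x) - (LINT x|lborel. u x * laplacian \<phi> x)\<bar>
        \<le> e * (LINT x|lborel. \<bar>laplacian \<phi> x\<bar>)"
    proof (rule diff)
      show "\<bar>v x - u x\<bar> \<le> e" if "x \<in> L" for x using u(4)[OF that] by (simp add: abs_minus_commute)
    qed (use int(2)[OF v(1)] int(2)[OF u(1)] int(2)[of "\<lambda>_. 1"] zero in auto)
    moreover have "\<bar>(LINT x|lborel. f (v x) * \<phi> x) - (LINT x|lborel. f (u x) * \<phi> x)\<bar>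
        \<le> e * (LINT x|lborel. \<bar>\<phi> x\<bar>)"
    proof (rule diff)
      show "\<bar>f (v x) - f (u x)\<bar> \<le> e" if "x \<in> L" for x
      proof -
        have "dist (f (v x)) (f (u x)) < e"
          using u(4)[OF that] u(2)[of x] v(2)[of x]
          by (intro d(2)) (simp_all add: abs_le_iff dist_real_def abs_minus_commute minus_le_iff)
        then show ?thesis by (simp add: dist_real_def)
      qed
    qed (use int(1)[OF fcomp[OF v(1)]] int(1)[OF fcomp[OF u(1)]] int(1)[of "\<lambda>_. 1"] zero in auto)
    moreover have "(LINT x|lborel. u x * laplacian \<phi> x) = (LINT x|lborel. f (u x) * \<phi> x)"
      using u(3) test by (simp add: weak_solution_iff)
    ultimately show ?thesis by (simp add: A_def distrib_left)
  qed
  have "\<bar>?I\<bar> \<le> 0"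
  proof (rule field_le_epsilon)
    fix e :: real assume e: "e > 0"
    have "\<bar>?I\<bar> \<le> e / (A + 1) * A" using bound[of "e / (A + 1)"] e A by simp
    also have "\<dots> \<le> e" using e A by (simp add: field_simps)
    finally show "\<bar>?I\<bar> \<le> 0 + e" by simp
  qed
  then show "(LINT x|lborel. v x * laplacian \<phi> x) = (LINT x|lborel. f (v x) * \<phi> x)" by simp
qed

text \<open>
  Both compactness of the attractor and attraction are instances of this statement on filters, the first
  for a filter concentrated on entire solutions, the second for a sequence of translates. Tychonoff's
  theorem in \<open>[-M, M]\<^bsup>space\<^esup>\<close> gives a pointwise cluster point \<open>w\<close>. Equicontinuity makes \<open>w\<close> uniformly
  continuous and upgrades pointwise closeness on a finite net to uniform closeness on a compact set, so no
  diagonal subsequences and no metric for the local topology are needed.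
\<close>

lemma bounded_solutions_cluster:
  fixes F :: "('a::euclidean_space \<Rightarrow>\<^sub>C real) filter"
  assumes f: "continuous_on UNIV f" and F: "F \<noteq> bot"
    and bounded: "\<forall>\<^sub>F u in F. \<forall>x. \<bar>apply_bcontfun u x\<bar> \<le> M"
    and sol: "\<And>R. \<forall>\<^sub>F u in F. weak_solution f (ball 0 R) (apply_bcontfun u)"
  obtains v where "v \<in> complete_bounded_solutions f"
    and "\<And>W. openin cloc W \<Longrightarrow> v \<in> W \<Longrightarrow> \<exists>\<^sub>F u in F. u \<in> W"
proof -
  let ?P = "PiE UNIV (\<lambda>_::'a. {-M..M})"
  have "compactin (product_topology (\<lambda>_::'a. euclidean) UNIV) ?P"
    by (simp add: compactin_PiE)
  then have "compact ?P" by (simp add: euclidean_product_topology)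
  moreover have "filtermap apply_bcontfun F \<noteq> bot" using F by (simp add: filtermap_bot_iff)
  moreover have "\<forall>\<^sub>F w in filtermap apply_bcontfun F. w \<in> ?P"
    unfolding eventually_filtermap using bounded
    by (rule eventually_mono) (auto simp: abs_le_iff minus_le_iff)
  ultimately obtain w where w: "w \<in> ?P" "inf (nhds w) (filtermap apply_bcontfun F) \<noteq> bot"
    unfolding compact_filter by blast
  have wM: "\<bar>w x\<bar> \<le> M" for x using w(1) by (auto simp: abs_le_iff minus_le_iff dest: PiE_mem[of _ _ _ x])
  have freq: "\<exists>u. Q u \<and> (\<forall>x\<in>X. \<bar>u x - w x\<bar> < e)"
    if X: "finite X" and e: "e > 0" and Q: "eventually Q F" for X e Q
  proof -
    have "open (\<Inter>x\<in>X. (\<lambda>g. g x) -` ball (w x) e)"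
      by (intro open_INT X ballI open_vimage open_ball continuous_on_product_coordinates)
    then have "\<forall>\<^sub>F g in nhds w. g \<in> (\<Inter>x\<in>X. (\<lambda>g. g x) -` ball (w x) e)"
      using e by (intro eventually_nhds_in_open) auto
    then have "\<forall>\<^sub>F g in inf (nhds w) (filtermap apply_bcontfun F). \<forall>x\<in>X. \<bar>g x - w x\<bar> < e"
      by (intro filter_leD[OF inf_le1])
        (auto elim!: eventually_mono simp: dist_real_def abs_minus_commute)
    moreover have "\<forall>\<^sub>F g in inf (nhds w) (filtermap apply_bcontfun F). \<exists>u. g = apply_bcontfun u \<and> Q u"
      using Q by (intro filter_leD[OF inf_le2]) (auto simp: eventually_filtermap elim!: eventually_mono)
    ultimately have "\<forall>\<^sub>F g in inf (nhds w) (filtermap apply_bcontfun F). \<exists>u. Q u \<and> (\<forall>x\<in>X. \<bar>u x - w x\<bar> < e)"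
      by eventually_elim auto
    then show ?thesis using w(2) eventually_happens by blast
  qed
  define good :: "real \<Rightarrow> ('a \<Rightarrow>\<^sub>C real) \<Rightarrow> bool" where "good R u \<longleftrightarrow> (\<forall>x. \<bar>apply_bcontfun u x\<bar> \<le> M) \<and> weak_solution f (ball 0 R) (apply_bcontfun u)" for R u
  have good: "eventually (good R) F" for R
    unfolding good_def using bounded sol by (rule eventually_conj)
  have equi: "\<exists>d>0. \<forall>R u x y. good (R + 2) u \<and> x \<in> ball 0 R \<and> y \<in> ball 0 R \<and> dist x y < d \<longrightarrow>
      \<bar>apply_bcontfun u x - apply_bcontfun u y\<bar> < e" if e: "e > 0" for e
  proof -
    obtain d where d: "d > 0" "\<And>(u::'a \<Rightarrow> real) \<Omega> x y. \<lbrakk>continuous_on UNIV u; \<And>z. \<bar>u z\<bar> \<le> M; weak_solution f \<Omega> u;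
       cball x 1 \<subseteq> \<Omega>; cball y 1 \<subseteq> \<Omega>; dist x y < d\<rbrakk> \<Longrightarrow> \<bar>u x - u y\<bar> < e"
      using bounded_weak_solutions_equicontinuous[OF f e] by blast
    have "cball x 1 \<subseteq> ball 0 (R + 2)" if "x \<in> ball 0 R" for x :: 'a and R
      using that by (simp add: cball_subset_ball_iff dist_commute)
    then have "\<bar>apply_bcontfun u x - apply_bcontfun u y\<bar> < e"
      if "good (R + 2) u" "x \<in> ball 0 R" "y \<in> ball 0 R" "dist x y < d" for R u x y
      using that by (intro d(2)[OF continuous_on_bcontfun, where \<Omega> = "ball 0 (R + 2)"]) (auto simp: good_def)
    then show ?thesis using d(1) by blast
  qed
  \<comment> \<open>The radius \<open>R\<close> may depend on the two points since the modulus \<open>d\<close> does not depend on it.\<close>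
  have w_unif: "\<exists>d>0. \<forall>x y. dist x y < d \<longrightarrow> \<bar>w x - w y\<bar> < e" if e: "e > 0" for e
  proof -
    obtain d where d: "d > 0" "\<And>R u x y. \<lbrakk>good (R + 2) u; x \<in> ball 0 R; y \<in> ball 0 R; dist x y < d\<rbrakk> \<Longrightarrow>
      \<bar>apply_bcontfun u x - apply_bcontfun u y\<bar> < e / 3"
      using equi[of "e / 3"] e by auto
    have "\<bar>w x - w y\<bar> < e" if "dist x y < d" for x y
    proof -
      define R where "R = norm x + norm y + 1"
      obtain u where u: "good (R + 2) u" "\<forall>z\<in>{x, y}. \<bar>apply_bcontfun u z - w z\<bar> < e / 3"
        using freq[of "{x, y}" "e / 3" "good (R + 2)"] e good by auto
      have "x \<in> ball 0 R" "y \<in> ball 0 R" by (auto simp: R_def add_nonneg_pos add_pos_nonneg)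
      then have "\<bar>apply_bcontfun u x - apply_bcontfun u y\<bar> < e / 3"
        using d(2)[OF u(1)] that by blast
      moreover have "\<bar>apply_bcontfun u x - w x\<bar> < e / 3" "\<bar>apply_bcontfun u y - w y\<bar> < e / 3"
        using u(2) by auto
      ultimately show ?thesis by linarith
    qed
    then show ?thesis using d(1) by blast
  qed
  have w_cont: "continuous_on UNIV w"
    unfolding continuous_on_iff dist_real_def using w_unif by (metis dist_commute)
  have close: "\<exists>u. Q u \<and> (\<forall>x\<in>K. \<bar>u x - w x\<bar> < e)"
    if K: "compact K" and e: "e > 0" and Q: "eventually Q F" for K e Q
  proof -
    obtain d1 where d1: "d1 > 0" "\<And>R u x y. \<lbrakk>good (R + 2) u; x \<in> ball 0 R; y \<in> ball 0 R; dist x y < d1\<rbrakk> \<Longrightarrow>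
      \<bar>apply_bcontfun u x - apply_bcontfun u y\<bar> < e / 3"
      using equi[of "e / 3"] e by auto
    obtain d2 where d2: "d2 > 0" "\<And>x y. dist x y < d2 \<Longrightarrow> \<bar>w x - w y\<bar> < e / 3"
      using w_unif[of "e / 3"] e by auto
    obtain X where X: "finite X" "K \<subseteq> (\<Union>x\<in>X. ball x (min d1 d2))"
      using K d1(1) d2(1) unfolding compact_eq_totally_bounded by (metis min_less_iff_conj)
    have "bounded (K \<union> X)" using K X(1) by (simp add: compact_imp_bounded finite_imp_bounded)
    then obtain R where R: "K \<union> X \<subseteq> ball 0 R"
      using bounded_subset_ballD by blast
    obtain u where u: "Q u" "good (R + 2) u" "\<And>x. x \<in> X \<Longrightarrow> \<bar>apply_bcontfun u x - w x\<bar> < e / 3"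
      using freq[OF X(1) _ eventually_conj[OF Q good[of "R + 2"]], of "e / 3"] e by auto
    have "\<bar>apply_bcontfun u z - w z\<bar> < e" if z: "z \<in> K" for z
    proof -
      obtain x where x: "x \<in> X" "dist x z < min d1 d2" using X(2) z by auto
      have "\<bar>apply_bcontfun u x - apply_bcontfun u z\<bar> < e / 3"
      proof (rule d1(2)[OF u(2)])
        show "x \<in> ball 0 R" "z \<in> ball 0 R" using x(1) z R by blast+
      qed (use x(2) in simp)
      moreover have "\<bar>w x - w z\<bar> < e / 3" using d2(2) x(2) by simp
      ultimately show ?thesis using u(3)[OF x(1)] by linarith
    qed
    then show ?thesis using u(1) by blast
  qed
  have "w \<in> bcontfun"
    using w_cont wM by (auto simp: bcontfun_def bounded_iff)
  then obtain v where v: "apply_bcontfun v = w" by (metis Bcontfun_inverse)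
  show thesis
  proof (rule that)
    have "weak_solution f UNIV w"
    proof (rule weak_solution_approx[OF f w_cont wM])
      fix R e and K :: "'a set" assume "compact K" "e > (0::real)"
      from close[OF this good[of R]] obtain u
        where "good R u" "\<forall>x\<in>K. \<bar>apply_bcontfun u x - w x\<bar> < e" by blast
      then show "\<exists>u. continuous_on UNIV u \<and> (\<forall>x. \<bar>u x\<bar> \<le> M) \<and>
          weak_solution f (ball 0 R) u \<and> (\<forall>x\<in>K. \<bar>u x - w x\<bar> < e)"
        using continuous_on_bcontfun[of UNIV u] by (auto simp: good_def)
    qed
    then show "v \<in> complete_bounded_solutions f" by (simp add: complete_bounded_solutions_def v)
  next
    fix W :: "('a \<Rightarrow>\<^sub>C real) set" assume W: "openin cloc W" "v \<in> W"
    then obtain K e where K: "compact K" "0 < e" "cloc_ball v K e \<subseteq> W"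
      unfolding openin_cloc cloc_open_def by blast
    show "\<exists>\<^sub>F u in F. u \<in> W"
      unfolding frequently_def
    proof
      assume "\<forall>\<^sub>F u in F. \<not> u \<in> W"
      from close[OF K(1,2) this] K(3) show False
        by (auto simp: cloc_ball_def v dist_real_def abs_minus_commute)
    qed
  qed
qed

section \<open>The attractor\<close>

text \<open>
  If an open cover \<open>\<U>\<close> had no finite subcover, the sets \<open>?K - U\<close> would generate a proper filter; the
  cluster point that \<open>bounded_solutions_cluster\<close> provides lies in some \<open>U\<close> of the cover, which the filter
  avoids.
\<close>

lemma compactin_complete_bounded_solutions:
  fixes f :: "real \<Rightarrow> real"
  assumes f: "continuous_on UNIV f" and eps: "\<epsilon> > 0"
    and coercive: "\<And>u. f u * u \<ge> - C + \<bar>u\<bar> powr (2 + \<epsilon>)"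
  shows "compactin cloc (complete_bounded_solutions f :: ('a::euclidean_space \<Rightarrow>\<^sub>C real) set)"
  unfolding compactin_def topspace_cloc
proof (intro conjI allI impI subset_UNIV)
  let ?K = "complete_bounded_solutions f :: ('a \<Rightarrow>\<^sub>C real) set"
  fix \<U> :: "('a \<Rightarrow>\<^sub>C real) set set"
  assume \<U>: "(\<forall>U\<in>\<U>. openin cloc U) \<and> ?K \<subseteq> \<Union>\<U>"
  show "\<exists>\<F>. finite \<F> \<and> \<F> \<subseteq> \<U> \<and> ?K \<subseteq> \<Union>\<F>"
  proof (rule ccontr)
    assume none: "\<nexists>\<F>. finite \<F> \<and> \<F> \<subseteq> \<U> \<and> ?K \<subseteq> \<Union>\<F>"
    define F where "F = (INF U\<in>\<U>. principal (?K - U))"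
    have F: "F \<noteq> bot"
      unfolding F_def
    proof (rule INF_filter_not_bot)
      fix X assume X: "X \<subseteq> \<U>" "finite X"
      then obtain u where "u \<in> ?K" "u \<notin> \<Union>X" using none by blast
      then have "(\<Inter>U\<in>X. ?K - U) \<noteq> {}" by blast
      then show "(INF U\<in>X. principal (?K - U)) \<noteq> bot"
        using X(2) by (simp add: INF_principal_finite principal_eq_bot_iff)
    qed
    have ev: "eventually (\<lambda>u. u \<in> ?K - U) F" if "U \<in> \<U>" for U
      unfolding F_def by (rule eventually_INF1[OF that]) (simp add: eventually_principal)
    have "\<U> \<noteq> {}"
    proof
      assume "\<U> = {}"
      then have "finite {} \<and> {} \<subseteq> \<U> \<and> ?K \<subseteq> \<Union>{}" using \<U> by simp
      then show False using none by metis
    qed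
    then obtain U0 where "U0 \<in> \<U>" by blast
    from ev[OF this] have inK: "eventually (\<lambda>u. u \<in> ?K) F" by (rule eventually_mono) simp
    have bdd: "\<bar>apply_bcontfun u x\<bar> \<le> \<bar>C\<bar> + 1" if "u \<in> ?K" for u x
    proof (rule entire_bounded_solution_abs_le[OF f continuous_on_bcontfun _ _ eps coercive])
      show "\<bar>apply_bcontfun u z\<bar> \<le> norm u" for z
        using norm_bounded[of u z] by simp
    qed (use that in \<open>simp add: complete_bounded_solutions_def\<close>)
    have "\<forall>\<^sub>F u in F. \<forall>x. \<bar>apply_bcontfun u x\<bar> \<le> \<bar>C\<bar> + 1"
      using inK by (rule eventually_mono) (simp add: bdd)
    moreover have "\<forall>\<^sub>F u in F. weak_solution f (ball 0 R) (apply_bcontfun u)" for R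
      using inK
      by (rule eventually_mono) (auto simp: complete_bounded_solutions_def intro: weak_solution_mono)
    ultimately obtain v where v: "v \<in> ?K" "\<And>W. openin cloc W \<Longrightarrow> v \<in> W \<Longrightarrow> \<exists>\<^sub>F u in F. u \<in> W"
      using bounded_solutions_cluster[OF f F] by blast
    obtain U where U: "U \<in> \<U>" "v \<in> U" using v(1) \<U> by blast
    have "\<exists>\<^sub>F u in F. u \<in> U" using v(2) U \<U> by blast
    moreover have "\<forall>\<^sub>F u in F. \<not> u \<in> U" using ev[OF U(1)] by (rule eventually_mono) simp
    ultimately show False by (simp add: frequently_def)
  qed
qed

text \<open>
  A ball is connected, so it cannot leave \<open>\<Omega>\<close> without meeting the frontier.
\<close>

lemma ball_subset_of_ext_dist_frontier:
  fixes h :: "'a::real_normed_vector"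
  assumes "h \<in> \<Omega>" and "ext_dist h (frontier \<Omega>) \<ge> ereal D"
  shows "ball h D \<subseteq> \<Omega>"
proof (cases "D > 0")
  case True
  show ?thesis
  proof (rule ccontr)
    assume "\<not> ball h D \<subseteq> \<Omega>"
    then have "ball h D \<inter> frontier \<Omega> \<noteq> {}"
    proof (intro connected_Int_frontier convex_connected convex_ball)
      show "ball h D \<inter> \<Omega> \<noteq> {}"
        using assms(1) True centre_in_ball by blast
    qed blast
    then obtain z where z: "z \<in> frontier \<Omega>" "dist h z < D" by auto
    have "ext_dist h (frontier \<Omega>) \<le> ereal (dist h z)"
      unfolding ext_dist_def by (rule INF_lower[OF z(1)])
    then have "ereal D \<le> ereal (dist h z)" using assms(2) order_trans by blast
    then show False using z(2) by simp
  qed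
qed (simp add: ball_empty)

text \<open>
  If attraction failed, there would be points \<open>h n\<close> at distance at least \<open>n\<close> from the frontier and solutions
  \<open>u n\<close> in \<open>B\<close> whose translates stay outside the neighbourhood. The translate by \<open>h n\<close> solves the equation on
  the ball of radius \<open>n\<close> about the origin, so a cluster point of the translates is an entire solution,
  contrary to the translates avoiding a neighbourhood of all of these.
\<close>

lemma attracting_complete_bounded_solutions:
  fixes \<Omega> :: "'a::euclidean_space set"
  assumes f: "continuous_on UNIV f"
  shows "attracting cloc translate (admissible_sets f \<Omega>) \<Omega> (complete_bounded_solutions f)"
  unfolding attracting_def topspace_cloc
proof (intro conjI ballI allI impI subset_UNIV)
  fix B :: "('a \<Rightarrow>\<^sub>C real) set" and N :: "('a \<Rightarrow>\<^sub>C real) set"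
  assume B: "B \<in> admissible_sets f \<Omega>" and N: "nbhd_of_set cloc (complete_bounded_solutions f) N"
  obtain W where W: "openin cloc W" "complete_bounded_solutions f \<subseteq> W" "W \<subseteq> N"
    using N by (auto simp: nbhd_of_set_def)
  obtain M where M: "\<And>u. u \<in> B \<Longrightarrow> norm u \<le> M"
    using B by (auto simp: admissible_sets_def bounded_iff)
  have sol: "weak_solution f \<Omega> (apply_bcontfun u)" if "u \<in> B" for u
    using B that by (auto simp: admissible_sets_def elliptic_bvp_solution_def)
  show "\<exists>D. \<forall>h\<in>\<Omega>. ereal D \<le> ext_dist h (frontier \<Omega>) \<longrightarrow> translate h ` B \<subseteq> N"
  proof (rule ccontr)
    assume "\<not> ?thesis"
    then have "\<forall>n::nat. \<exists>h u. h \<in> \<Omega> \<and> ereal (real n) \<le> ext_dist h (frontier \<Omega>) \<and> u \<in> B \<and> translate h u \<notin> N"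
      by (metis image_subsetI)
    then obtain h u where hu: "\<And>n::nat. h n \<in> \<Omega>" "\<And>n. ereal (real n) \<le> ext_dist (h n) (frontier \<Omega>)"
        "\<And>n. u n \<in> B" "\<And>n. translate (h n) (u n) \<notin> N"
      by metis
    define F where "F = filtermap (\<lambda>n. translate (h n) (u n)) sequentially"
    have F: "F \<noteq> bot" by (simp add: F_def filtermap_bot_iff)
    have "\<bar>apply_bcontfun (translate (h n) (u n)) x\<bar> \<le> M" for n x
      using norm_bounded[of "u n" "x + h n"] M[OF hu(3)[of n]] by (simp add: apply_translate)
    then have "\<forall>\<^sub>F v in F. \<forall>x. \<bar>apply_bcontfun v x\<bar> \<le> M" by (simp add: F_def eventually_filtermap)
    moreover have "\<forall>\<^sub>F v in F. weak_solution f (ball 0 R) (apply_bcontfun v)" for R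
      unfolding F_def eventually_filtermap
    proof (rule eventually_mono)
      show "eventually (\<lambda>n. R \<le> real n) sequentially"
        by (rule eventually_sequentiallyI[of "nat \<lceil>R\<rceil>"]) linarith
      fix n assume n: "R \<le> real n"
      have "ball (h n) (real n) \<subseteq> \<Omega>"
        by (rule ball_subset_of_ext_dist_frontier[OF hu(1,2)])
      then have "ball 0 R \<subseteq> {x. x + h n \<in> \<Omega>}"
        using n by (auto simp: subset_iff dist_norm)
      then show "weak_solution f (ball 0 R) (apply_bcontfun (translate (h n) (u n)))"
        by (rule weak_solution_mono[OF weak_solution_translate[OF f sol[OF hu(3)]]])
    qed
    ultimately obtain v where "v \<in> complete_bounded_solutions f"
        "\<And>W. openin cloc W \<Longrightarrow> v \<in> W \<Longrightarrow> \<exists>\<^sub>F u in F. u \<in> W"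
      using bounded_solutions_cluster[OF f F] by blast
    then have "\<exists>\<^sub>F v in F. v \<in> W" using W by blast
    moreover have "\<forall>\<^sub>F v in F. \<not> v \<in> W"
      unfolding F_def eventually_filtermap using hu(4) W(3) by (intro always_eventually allI) blast
    ultimately show False by (simp add: frequently_def)
  qed
qed

theorem proposition3p6:
  fixes \<Omega> :: "'a::euclidean_space set"
    and f :: "real \<Rightarrow> real"
    and C \<epsilon> :: real
    and k :: nat
  assumes "open \<Omega>" and "connected \<Omega>" and "\<Omega> \<noteq> {}"
    and "k \<ge> 1" and "Ck_boundary k \<Omega>"
    and "\<And>D::real. D > 0 \<Longrightarrow> \<exists>h\<in>\<Omega>. ext_dist h (frontier \<Omega>) \<ge> ereal D"
    and "continuous_on UNIV f"
    and "\<epsilon> > 0"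
    and "\<And>u. f u * u \<ge> - C + \<bar>u\<bar> powr (2 + \<epsilon>)"
  shows "attractor cloc translate (admissible_sets f \<Omega>) \<Omega> (complete_bounded_solutions f)"
  unfolding attractor_def
  by (intro conjI allI compactin_complete_bounded_solutions[OF assms(7,8,9)]
      translate_complete_bounded_solutions[OF assms(7)]
      attracting_complete_bounded_solutions[OF assms(7)])

end
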